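(* Let $\beta>0$, let $d/2\le s<d$ with $s>0$, and assume $\mu\in L^\infty\cap\mathcal P(\mathbb R^d)$. There exist constants $c,C>0$ and $N_0\ge3$, depending on $(\beta,\mu,d,s)$, such that, for every $N\ge N_0$, $$\mathsf K_{N,\beta}(\mu)\ge C^{-1}\begin{cases}(\log N)^c,&s=d/2,\\ \exp\{c(\log N)^{2-d/s}\},&d/2<s<d.\end{cases}$$ In particular, $\mathsf K_{N,\beta}(\mu)\to+\infty$ as $N\to\infty$ throughout $d/2\le s<d$.
   Context: Fix a dimension $d\ge1$. $\mathcal P(\mathbb R^d)$ is the set of Borel probability measures; $\mu\in L^\infty\cap\mathcal P(\mathbb R^d)$ means $\mu$ has a bounded Lebesgue density. For $0<s<d$ the Riesz kernel is $\mathsf g(x)=\frac1s|x|^{-s}$. Set $h_\mu(x)=\int\mathsf g(x-y)d\mu(y)$, $I_\mu=\frac12\iint\mathsf g(x-y)d\mu(x)d\mu(y)$, and $\tilde{\mathsf g}(x,y)=\mathsf g(x-y)-h_\mu(x)-h_\mu(y)+2I_\mu$. For $X_N=(x_1,\dots,x_N)\in(\mathbb R^d)^N$, $$\mathsf F_N(X_N,\mu)=\frac1{2N^2}\sum_{1\le i\ne j\le N}\tilde{\mathsf g}(x_i,x_j)-\frac1{N^2}\sum_{i=1}^Nh_\mu(x_i)+\frac1NI_\mu,\qquad \mathsf K_{N,\beta}(\mu)=\mathbb E_{\mu^{\otimes N}}\big[\exp\{-\beta N\mathsf F_N(X_N,\mu)\}\big].$$ *)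

theory Defs
  imports "HOL-Probability.Probability"
begin

text \<open>Since \<open>0 powr a = 0\<close>, the kernel takes the value 0 (instead of infinity) at the
  origin. For measures with a Lebesgue density all integrals below are unaffected, because the
  diagonal is a null set.\<close>

definition riesz_kernel :: "real \<Rightarrow> real ^ 'd \<Rightarrow> real" where
  "riesz_kernel s x = (1 / s) * norm x powr (- s)"

definition bounded_density_prob :: "(real ^ 'd) measure \<Rightarrow> bool" where
  "bounded_density_prob \<mu> \<longleftrightarrow> prob_space \<mu> \<and>
     (\<exists>f M. f \<in> borel_measurable borel \<and> (\<forall>x. 0 \<le> f x) \<and> (AE x in lborel. f x \<le> M) \<and>
        \<mu> = density lborel (\<lambda>x. ennreal (f x)))"

definition riesz_potential :: "real \<Rightarrow> (real ^ 'd) measure \<Rightarrow> real ^ 'd \<Rightarrow> real" where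
  "riesz_potential s \<mu> x = (\<integral>y. riesz_kernel s (x - y) \<partial>\<mu>)"

definition riesz_energy :: "real \<Rightarrow> (real ^ 'd) measure \<Rightarrow> real" where
  "riesz_energy s \<mu> = 1 / 2 * (\<integral>x. (\<integral>y. riesz_kernel s (x - y) \<partial>\<mu>) \<partial>\<mu>)"

definition centered_kernel ::
    "real \<Rightarrow> (real ^ 'd) measure \<Rightarrow> real ^ 'd \<Rightarrow> real ^ 'd \<Rightarrow> real" where
  "centered_kernel s \<mu> x y =
     riesz_kernel s (x - y) - riesz_potential s \<mu> x - riesz_potential s \<mu> y + 2 * riesz_energy s \<mu>"

definition modulated_energy ::
    "real \<Rightarrow> (real ^ 'd) measure \<Rightarrow> nat \<Rightarrow> (nat \<Rightarrow> real ^ 'd) \<Rightarrow> real" where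
  "modulated_energy s \<mu> N X =
     1 / (2 * real N ^ 2) * (\<Sum>i\<in>{1..N}. \<Sum>j\<in>{1..N} - {i}. centered_kernel s \<mu> (X i) (X j))
     - 1 / real N ^ 2 * (\<Sum>i\<in>{1..N}. riesz_potential s \<mu> (X i))
     + 1 / real N * riesz_energy s \<mu>"

definition partition_function :: "real \<Rightarrow> real \<Rightarrow> (real ^ 'd) measure \<Rightarrow> nat \<Rightarrow> real" where
  "partition_function s \<beta> \<mu> N =
     (\<integral>X. exp (- \<beta> * real N * modulated_energy s \<mu> N X) \<partial>(PiM {1..N} (\<lambda>_. \<mu>)))"

end

theory Submission
  imports Defs "HOL-Real_Asymp.Real_Asymp"
begin

text \<open>Write \<open>U\<close> for the sum of the centered kernel \<open>k\<close> over ordered pairs of distinct particles.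
  Since the potential is nonnegative, the partition function is at least
  \<open>exp (- \<beta> I)\<close> times the mean of \<open>exp (- (\<beta> / 2N) U)\<close>; since \<open>exp w \<ge> max w 0\<close> and \<open>U\<close> has mean
  zero, it suffices to bound the mean of \<open>\<bar>U\<bar> / N\<close> from below. This gives a power of
  \<open>ln N\<close> if \<open>s = d / 2\<close> and even a power of \<open>N\<close> if \<open>s > d / 2\<close>.

  The kernel \<open>k\<close> integrates to zero in each variable, so restricting the sum to a subset of the
  particles does not increase the mean of \<open>\<bar>U\<bar>\<close>. Hence random signs \<open>\<epsilon>\<^sub>i \<epsilon>\<^sub>j\<close> may be
  inserted at the cost of a factor 5, and hypercontractivity for quadratic forms in signs bounds the
  mean of \<open>\<bar>U\<bar>\<close> below by the mean of the square root of the sum of \<open>k\<^sup>2\<close>. Finally \<open>k\<^sup>2\<close> dominates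
  a multiple of \<open>\<bar>x - y\<bar>\<close> to the power \<open>- 2s\<close>, cut off at a distance decaying like \<open>N\<close> to
  the power \<open>- 1 / s\<close>; the integral of this truncation diverges as \<open>N\<close> grows precisely because \<open>2s \<ge> d\<close>.\<close>

section \<open>Quadratic forms in random signs\<close>

text \<open>The obstacle is that \<open>k\<close> has no second moment when 2s >= d, while
  truncating \<open>k\<close> itself would destroy its degeneracy. The truncation is therefore
  applied only to the square of \<open>k\<close>, after the random signs have turned |U| into a
  square function that is finite at every configuration. Let Y be the sum of the truncated square
  over ordered pairs. Up to constants, its mean is N^2 p, where p is the integral of the truncation,
  and its second moment is at most N^4 p^2 + N^2 b p, where b is the maximum of the truncation.
  These match as soon as b <= N^2 p, and a cutoff distance N^(-1/s) makes b of order N^2: this is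
  the origin of the cutoff. Then sqrt Y has mean at least of order N sqrt p, and the factor 1/N
  leaves sqrt p.

  As the density is merely bounded, the mass near a point can be bounded below only on average. This
  suffices: upper bounds are needed at every point, lower bounds only in the mean, and the two agree
  up to a constant on geometric annuli whose ratio \<rho> is adapted to \<mu>.\<close>

definition sign_of :: "'i set \<Rightarrow> 'i \<Rightarrow> real" where
  "sign_of T i = (if i \<in> T then 1 else - 1)"

lemma sign_of_insert_neq [simp]: "i \<noteq> a \<Longrightarrow> sign_of (insert a T) i = sign_of T i"
  by (simp add: sign_of_def)

lemma sum_Pow_insert:
  fixes F :: "'i set \<Rightarrow> real"
  assumes "finite J" "a \<notin> J"
  shows "(\<Sum>T\<in>Pow (insert a J). F T) = (\<Sum>T\<in>Pow J. F T + F (insert a T))"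
proof -
  have "inj_on (insert a) (Pow J)"
    using assms(2) by (auto simp: inj_on_def)
  moreover have "Pow J \<inter> insert a ` Pow J = {}"
    using assms(2) by auto
  ultimately show ?thesis
    using assms(1) by (simp add: Pow_insert sum.union_disjoint sum.reindex sum.distrib)
qed

text \<open>A sign pattern is encoded by the set \<open>T\<close> of the indices with sign +1. An
  expectation over independent signs is then a sum over \<open>Pow J\<close> divided by 2^(card J),
  and no probability space for the signs is needed.\<close>

definition rad_lin :: "('i \<Rightarrow> real) \<Rightarrow> 'i set \<Rightarrow> 'i set \<Rightarrow> real" where
  "rad_lin c J T = (\<Sum>i\<in>J. c i * sign_of T i)"

definition rad_quad :: "('i \<Rightarrow> 'i \<Rightarrow> real) \<Rightarrow> 'i set \<Rightarrow> 'i set \<Rightarrow> real" where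
  "rad_quad a J T = (\<Sum>i\<in>J. \<Sum>j\<in>J - {i}. a i j * (sign_of T i * sign_of T j))"

lemma rad_lin_insert_out:
  assumes "finite J" "b \<notin> J" "T \<subseteq> J"
  shows "rad_lin c (insert b J) T = rad_lin c J T - c b"
    and "rad_lin c (insert b J) (insert b T) = rad_lin c J T + c b"
proof -
  have "b \<notin> T" using assms by auto
  then show "rad_lin c (insert b J) T = rad_lin c J T - c b"
    using assms by (simp add: rad_lin_def sign_of_def)
  have "(\<Sum>i\<in>J. c i * sign_of (insert b T) i) = (\<Sum>i\<in>J. c i * sign_of T i)"
    using assms(2) by (intro sum.cong refl) (metis sign_of_insert_neq)
  then show "rad_lin c (insert b J) (insert b T) = rad_lin c J T + c b"
    using assms by (simp add: rad_lin_def) (simp add: sign_of_def)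
qed

lemma sum_offdiag_insert:
  fixes f :: "'i \<Rightarrow> 'i \<Rightarrow> real"
  assumes "finite J" "b \<notin> J"
  shows "(\<Sum>i\<in>insert b J. \<Sum>j\<in>insert b J - {i}. f i j) =
    (\<Sum>i\<in>J. \<Sum>j\<in>J - {i}. f i j) + (\<Sum>i\<in>J. f i b + f b i)"
proof -
  have "(\<Sum>j\<in>insert b J - {i}. f i j) = f i b + (\<Sum>j\<in>J - {i}. f i j)" if "i \<in> J" for i
  proof -
    have "insert b J - {i} = insert b (J - {i})" using that assms by auto
    then show ?thesis using assms by simp
  qed
  then have "(\<Sum>i\<in>J. \<Sum>j\<in>insert b J - {i}. f i j)
      = (\<Sum>i\<in>J. f i b) + (\<Sum>i\<in>J. \<Sum>j\<in>J - {i}. f i j)"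
    by (simp add: sum.distrib)
  moreover have "insert b J - {b} = J" using assms by auto
  ultimately show ?thesis using assms by (simp add: sum.distrib)
qed

text \<open>Ordered pairs meet the new index twice and \<open>a\<close> is symmetric, hence the
  coefficients \<open>2 * a b i\<close> of the linear part.\<close>

lemma rad_quad_insert_out:
  assumes "finite J" "b \<notin> J" "T \<subseteq> J" "\<And>i j. a i j = a j i"
  shows "rad_quad a (insert b J) T = rad_quad a J T - rad_lin (\<lambda>i. 2 * a b i) J T"
    and "rad_quad a (insert b J) (insert b T) = rad_quad a J T + rad_lin (\<lambda>i. 2 * a b i) J T"
proof -
  have bT: "b \<notin> T" using assms by auto
  have sb: "sign_of T b = - 1" "sign_of (insert b T) b = 1"
    using bT by (simp_all add: sign_of_def)
  show "rad_quad a (insert b J) T = rad_quad a J T - rad_lin (\<lambda>i. 2 * a b i) J T"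
    unfolding rad_quad_def rad_lin_def sum_offdiag_insert[OF assms(1,2)]
    by (simp add: sb assms(4)[of _ b] sum_negf[symmetric] mult.commute mult.left_commute)
  have *: "i \<in> J \<Longrightarrow> sign_of (insert b T) i = sign_of T i" for i
    using assms(2) by (intro sign_of_insert_neq) auto
  have q: "rad_quad a J (insert b T) = rad_quad a J T"
    unfolding rad_quad_def by (intro sum.cong refl) (auto simp: *)
  have "rad_quad a (insert b J) (insert b T)
      = rad_quad a J (insert b T) + (\<Sum>i\<in>J. 2 * a b i * sign_of (insert b T) i)"
    unfolding rad_quad_def sum_offdiag_insert[OF assms(1,2)]
    by (simp add: sb assms(4)[of _ b] mult.assoc)
  then show "rad_quad a (insert b J) (insert b T) = rad_quad a J T + rad_lin (\<lambda>i. 2 * a b i) J T"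
    by (simp add: q rad_lin_def *)
qed

text \<open>Averaging over the two signs of \<open>b\<close> cancels the odd powers of
  \<open>Y\<close> in the expansions of X - Y and X + Y. This is the common induction step of the
  four moment computations below.\<close>

lemma sum_Pow_even_moments:
  fixes X Y :: "'i set \<Rightarrow> real"
  assumes "finite J" "b \<notin> J"
    and "\<And>T. T \<subseteq> J \<Longrightarrow> F T = X T - Y T" "\<And>T. T \<subseteq> J \<Longrightarrow> F (insert b T) = X T + Y T"
  shows "(\<Sum>T\<in>Pow (insert b J). F T ^ 2) = 2 * ((\<Sum>T\<in>Pow J. X T ^ 2) + (\<Sum>T\<in>Pow J. Y T ^ 2))"
    and "(\<Sum>T\<in>Pow (insert b J). F T ^ 4) = 2 * ((\<Sum>T\<in>Pow J. X T ^ 4)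
           + 6 * (\<Sum>T\<in>Pow J. X T ^ 2 * Y T ^ 2) + (\<Sum>T\<in>Pow J. Y T ^ 4))"
proof -
  have 2: "(x - y) ^ 2 + (x + y) ^ 2 = 2 * (x ^ 2 + y ^ 2)" for x y :: real
    by (simp add: power2_eq_square algebra_simps)
  have 4: "(x - y) ^ 4 + (x + y) ^ 4 = 2 * (x ^ 4 + 6 * (x ^ 2 * y ^ 2) + y ^ 4)" for x y :: real
    by (simp add: power4_eq_xxxx power2_eq_square algebra_simps)
  show "(\<Sum>T\<in>Pow (insert b J). F T ^ 2) = 2 * ((\<Sum>T\<in>Pow J. X T ^ 2) + (\<Sum>T\<in>Pow J. Y T ^ 2))"
    unfolding sum_Pow_insert[OF assms(1,2)] sum.distrib[symmetric] sum_distrib_left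
    by (intro sum.cong refl) (simp add: assms(3,4) 2)
  show "(\<Sum>T\<in>Pow (insert b J). F T ^ 4) = 2 * ((\<Sum>T\<in>Pow J. X T ^ 4)
           + 6 * (\<Sum>T\<in>Pow J. X T ^ 2 * Y T ^ 2) + (\<Sum>T\<in>Pow J. Y T ^ 4))"
    unfolding sum_Pow_insert[OF assms(1,2)] sum_distrib_left sum.distrib[symmetric]
    by (intro sum.cong refl) (simp add: assms(3,4) 4)
qed

lemma rad_lin_moment2:
  assumes "finite J"
  shows "(\<Sum>T\<in>Pow J. rad_lin c J T ^ 2) = 2 ^ card J * (\<Sum>i\<in>J. c i ^ 2)"
  using assms
proof (induction J rule: finite_induct)
  case (insert b J)
  then show ?case
    by (subst sum_Pow_even_moments(1)[OF insert.hyps, where X = "rad_lin c J" and Y = "\<lambda>_. c b"])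
       (simp_all add: rad_lin_insert_out card_Pow algebra_simps)
qed (simp add: rad_lin_def)

text \<open>Khinchin's inequality with the Gaussian constant 3. The induction closes because the
  factor 6 of the mixed moment is exactly the cross term of 3 (x + y)^2; only c^4 <= 3 c^4 is
  lost.\<close>

lemma rad_lin_moment4:
  assumes "finite J"
  shows "(\<Sum>T\<in>Pow J. rad_lin c J T ^ 4) \<le> 2 ^ card J * (3 * (\<Sum>i\<in>J. c i ^ 2) ^ 2)"
  using assms
proof (induction J rule: finite_induct)
  case (insert b J)
  let ?n = "2 ^ card J :: real" and ?s = "\<Sum>i\<in>J. c i ^ 2"
  have "(\<Sum>T\<in>Pow (insert b J). rad_lin c (insert b J) T ^ 4)
      = 2 * ((\<Sum>T\<in>Pow J. rad_lin c J T ^ 4) + 6 * (\<Sum>T\<in>Pow J. rad_lin c J T ^ 2 * c b ^ 2)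
        + (\<Sum>T\<in>Pow J. c b ^ 4))"
    by (rule sum_Pow_even_moments(2)[OF insert.hyps]) (simp_all add: rad_lin_insert_out insert.hyps)
  also have "(\<Sum>T\<in>Pow J. rad_lin c J T ^ 2 * c b ^ 2) = ?n * ?s * c b ^ 2"
    by (simp add: sum_distrib_right[symmetric] rad_lin_moment2 insert.hyps)
  also have "(\<Sum>T\<in>Pow J. c b ^ 4) = ?n * c b ^ 4"
    by (simp add: card_Pow insert.hyps)
  also have "2 * ((\<Sum>T\<in>Pow J. rad_lin c J T ^ 4) + 6 * (?n * ?s * c b ^ 2) + ?n * c b ^ 4)
      \<le> 2 * (?n * (3 * ?s ^ 2) + 6 * (?n * ?s * c b ^ 2) + ?n * (3 * c b ^ 4))"
    using insert.IH by (intro mult_left_mono add_mono) (auto intro!: mult_nonneg_nonneg sum_nonneg)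
  also have "\<dots> = 2 ^ card (insert b J) * (3 * (\<Sum>i\<in>insert b J. c i ^ 2) ^ 2)"
    using insert.hyps by (simp add: power2_eq_square power4_eq_xxxx algebra_simps)
  finally show ?case .
qed (simp add: rad_lin_def)

lemma rad_quad_moment2:
  assumes "finite J" "\<And>i j. a i j = a j i"
  shows "(\<Sum>T\<in>Pow J. rad_quad a J T ^ 2) = 2 ^ card J * (2 * (\<Sum>i\<in>J. \<Sum>j\<in>J - {i}. a i j ^ 2))"
  using assms(1)
proof (induction J rule: finite_induct)
  case (insert b J)
  have "(\<Sum>T\<in>Pow (insert b J). rad_quad a (insert b J) T ^ 2)
     = 2 * ((\<Sum>T\<in>Pow J. rad_quad a J T ^ 2) + (\<Sum>T\<in>Pow J. rad_lin (\<lambda>i. 2 * a b i) J T ^ 2))"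
    by (rule sum_Pow_even_moments(1)[OF insert.hyps])
       (simp_all add: rad_quad_insert_out[OF insert.hyps _ assms(2)])
  then show ?case
    unfolding sum_offdiag_insert[OF insert.hyps] insert.IH rad_lin_moment2[OF insert.hyps(1)]
    using insert.hyps
    by (simp add: assms(2)[of _ b] power_mult_distrib sum_distrib_left[symmetric] algebra_simps)
qed (simp add: rad_quad_def)

text \<open>Hypercontractivity in degree two, where 81 = 9^2 is the usual constant. The quadratic
  and the linear part share their signs, so the mixed moment is separated by Cauchy-Schwarz, using
  the bounds 81 and 3 for the two fourth moments.\<close>

lemma rad_quad_moment4:
  assumes "finite J" "\<And>i j. a i j = a j i"
  shows "(\<Sum>T\<in>Pow J. rad_quad a J T ^ 4)
    \<le> 2 ^ card J * (81 * (2 * (\<Sum>i\<in>J. \<Sum>j\<in>J - {i}. a i j ^ 2)) ^ 2)"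
  using assms(1)
proof (induction J rule: finite_induct)
  case (insert b J)
  let ?n = "2 ^ card J :: real" and ?s = "2 * (\<Sum>i\<in>J. \<Sum>j\<in>J - {i}. a i j ^ 2)"
  let ?q = "rad_quad a J" and ?l = "rad_lin (\<lambda>i. 2 * a b i) J"
  let ?t = "\<Sum>i\<in>J. (2 * a b i) ^ 2"
  have s0: "?s \<ge> 0" "?t \<ge> 0" by (auto intro!: sum_nonneg)
  have l4: "(\<Sum>T\<in>Pow J. ?l T ^ 4) \<le> ?n * (3 * ?t ^ 2)"
    by (rule rad_lin_moment4) (rule insert.hyps)
  have "(\<Sum>T\<in>Pow J. ?q T ^ 2 * ?l T ^ 2) ^ 2 \<le> (\<Sum>T\<in>Pow J. (?q T ^ 2) ^ 2) * (\<Sum>T\<in>Pow J. (?l T ^ 2) ^ 2)"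
    by (rule Cauchy_Schwarz_ineq_sum)
  also have "\<dots> = (\<Sum>T\<in>Pow J. ?q T ^ 4) * (\<Sum>T\<in>Pow J. ?l T ^ 4)"
    by (simp flip: power_mult)
  also have "\<dots> \<le> (?n * (81 * ?s ^ 2)) * (?n * (3 * ?t ^ 2))"
    using insert.IH l4 by (intro mult_mono) (auto intro!: sum_nonneg)
  also have "\<dots> = 243 * (?n * (?s * ?t)) ^ 2"
    by (simp add: power2_eq_square algebra_simps)
  \<comment> \<open>243 = 81 * 3 is rounded up to a square. There is ample room: the mixed term
    becomes 6 * 16 = 96, and 2 * 81 = 162 is allowed.\<close>
  also have "\<dots> \<le> 256 * (?n * (?s * ?t)) ^ 2"
    by (intro mult_right_mono) auto
  also have "\<dots> = (16 * (?n * (?s * ?t))) ^ 2"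
    by (simp add: power_mult_distrib)
  finally have cs: "(\<Sum>T\<in>Pow J. ?q T ^ 2 * ?l T ^ 2) \<le> 16 * (?n * (?s * ?t))"
    using s0 by (elim power2_le_imp_le) auto
  have "(\<Sum>T\<in>Pow (insert b J). rad_quad a (insert b J) T ^ 4)
     = 2 * ((\<Sum>T\<in>Pow J. ?q T ^ 4) + 6 * (\<Sum>T\<in>Pow J. ?q T ^ 2 * ?l T ^ 2) + (\<Sum>T\<in>Pow J. ?l T ^ 4))"
    by (rule sum_Pow_even_moments(2)[OF insert.hyps])
       (simp_all add: rad_quad_insert_out[OF insert.hyps _ assms(2)])
  also have "\<dots> \<le> 2 * (?n * (81 * ?s ^ 2) + 6 * (16 * (?n * (?s * ?t))) + ?n * (3 * ?t ^ 2))"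
    using insert.IH l4 cs by (intro mult_left_mono add_mono) auto
  also have "\<dots> = 2 * ?n * (81 * ?s ^ 2 + 96 * (?s * ?t) + 3 * ?t ^ 2)"
    by (simp add: algebra_simps)
  also have "\<dots> \<le> 2 * ?n * (81 * ?s ^ 2 + 162 * (?s * ?t) + 81 * ?t ^ 2)"
    using s0 by (intro mult_left_mono add_mono mult_right_mono) auto
  also have "\<dots> = 2 * ?n * (81 * (?s + ?t) ^ 2)"
    by (simp add: power2_eq_square algebra_simps)
  also have "?s + ?t = 2 * (\<Sum>i\<in>insert b J. \<Sum>j\<in>insert b J - {i}. a i j ^ 2)"
    unfolding sum_offdiag_insert[OF insert.hyps]
    by (simp add: assms(2)[of _ b] power_mult_distrib sum_distrib_left[symmetric])
  finally show ?case using insert.hyps by simp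
qed (simp add: rad_quad_def)

text \<open>The scaled form of y^2 - y^4 <= y. It replaces the Hoelder interpolation of the second
  moment between the first and the fourth: being linear in the moments, it can be summed or
  integrated termwise, and \<open>t\<close> is optimised afterwards.\<close>

lemma abs_ge_interpolation:
  fixes q t :: real
  assumes "t > 0"
  shows "\<bar>q\<bar> \<ge> q ^ 2 / t - q ^ 4 / t ^ 3"
proof -
  define y where "y = \<bar>q\<bar> / t"
  have y0: "y \<ge> 0" using assms by (simp add: y_def)
  have "y ^ 2 - y ^ 4 \<le> y"
  proof (cases "y \<le> 1")
    case True
    then have "y ^ 2 \<le> y" using y0 by (simp add: power2_eq_square mult_left_le)
    then show ?thesis using zero_le_power[OF y0, of 4] by linarith
  next
    case False
    then have "y ^ 2 \<le> y ^ 4" by (intro power_increasing) auto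
    then show ?thesis using y0 by linarith
  qed
  then have "(y ^ 2 - y ^ 4) * t \<le> y * t" using assms by (intro mult_right_mono) auto
  moreover have "y * t = \<bar>q\<bar>" "y ^ 2 * t = q ^ 2 / t" "y ^ 4 * t = q ^ 4 / t ^ 3"
    using assms by (simp_all add: y_def power_divide power2_eq_square power3_eq_cube power4_eq_xxxx
        abs_mult_self_eq mult.assoc[symmetric])
  ultimately show ?thesis by (simp add: left_diff_distrib)
qed

lemma rad_quad_abs_ge:
  assumes "finite J" "\<And>i j. a i j = a j i"
  shows "(\<Sum>T\<in>Pow J. \<bar>rad_quad a J T\<bar>)
    \<ge> 2 ^ card J * (sqrt (\<Sum>i\<in>J. \<Sum>j\<in>J - {i}. a i j ^ 2) / 30)"
proof -
  let ?n = "2 ^ card J :: real"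
  define s where "s = sqrt (2 * (\<Sum>i\<in>J. \<Sum>j\<in>J - {i}. a i j ^ 2))"
  have s2: "2 * (\<Sum>i\<in>J. \<Sum>j\<in>J - {i}. a i j ^ 2) = s ^ 2"
    unfolding s_def by (simp add: sum_nonneg)
  have s0: "s \<ge> 0" unfolding s_def by (simp add: sum_nonneg)
  have le: "sqrt (\<Sum>i\<in>J. \<Sum>j\<in>J - {i}. a i j ^ 2) \<le> s"
    unfolding s_def by (simp add: sum_nonneg)
  have m2: "(\<Sum>T\<in>Pow J. rad_quad a J T ^ 2) = ?n * s ^ 2"
    using rad_quad_moment2[where a = a, OF assms] by (simp add: s2)
  have m4: "(\<Sum>T\<in>Pow J. rad_quad a J T ^ 4) \<le> ?n * (81 * (s ^ 2) ^ 2)"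
    using rad_quad_moment4[where a = a, OF assms] unfolding s2 .
  have "?n * (s / 30) \<le> (\<Sum>T\<in>Pow J. \<bar>rad_quad a J T\<bar>)"
  proof (cases "s = 0")
    case True
    then show ?thesis by (simp add: sum_nonneg)
  next
    case False
    then have s: "s > 0" using s0 by simp
    \<comment> \<open>The choice t = 12 s gives the coefficient 1/12 - 81/12^3 = 7/192, which
      exceeds 1/30.\<close>
    have "?n * (s / 30) \<le> ?n * (s ^ 2 / (12 * s) - 81 * (s ^ 2) ^ 2 / (12 * s) ^ 3)"
      using s by (intro mult_left_mono) (simp_all add: power2_eq_square power3_eq_cube)
    also have "\<dots> = (?n * s ^ 2) / (12 * s) - (?n * (81 * (s ^ 2) ^ 2)) / (12 * s) ^ 3"
      by (simp add: right_diff_distrib)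
    also have "\<dots> \<le> (\<Sum>T\<in>Pow J. rad_quad a J T ^ 2) / (12 * s) - (\<Sum>T\<in>Pow J. rad_quad a J T ^ 4) / (12 * s) ^ 3"
      unfolding m2 using m4 s by (intro diff_mono divide_right_mono) auto
    also have "\<dots> = (\<Sum>T\<in>Pow J. rad_quad a J T ^ 2 / (12 * s) - rad_quad a J T ^ 4 / (12 * s) ^ 3)"
      by (simp add: sum_subtractf sum_divide_distrib)
    also have "\<dots> \<le> (\<Sum>T\<in>Pow J. \<bar>rad_quad a J T\<bar>)"
      using s by (intro sum_mono abs_ge_interpolation) auto
    finally show ?thesis .
  qed
  moreover have "?n * (sqrt (\<Sum>i\<in>J. \<Sum>j\<in>J - {i}. a i j ^ 2) / 30) \<le> ?n * (s / 30)"
    using le by (intro mult_left_mono divide_right_mono) auto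
  ultimately show ?thesis by linarith
qed

section \<open>Degenerate pair sums\<close>

definition pair_sum :: "('a \<Rightarrow> 'a \<Rightarrow> real) \<Rightarrow> 'i set \<Rightarrow> ('i \<Rightarrow> 'a) \<Rightarrow> real" where
  "pair_sum k J x = (\<Sum>i\<in>J. \<Sum>j\<in>J - {i}. k (x i) (x j))"

lemma pair_sum_fun_upd: "b \<notin> J \<Longrightarrow> pair_sum k J (x(b := y)) = pair_sum k J x"
  unfolding pair_sum_def by (intro sum.cong refl) auto

lemma measurable_pair_sum:
  assumes [measurable]: "case_prod k \<in> borel_measurable (M \<Otimes>\<^sub>M M)" and "J \<subseteq> I"
  shows "pair_sum k J \<in> borel_measurable (PiM I (\<lambda>_. M))"
proof -
  have "(\<lambda>x. case_prod k (x i, x j)) \<in> borel_measurable (PiM I (\<lambda>_. M))" if "i \<in> J" "j \<in> J" for i j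
    using that assms(2) by (intro measurable_compose[OF _ assms(1)]) (auto intro!: measurable_Pair measurable_component_singleton)
  then show ?thesis unfolding pair_sum_def by (intro borel_measurable_sum) auto
qed

text \<open>For each pair, the product of the two signs is twice the indicator that both indices lie
  in \<open>T\<close>, plus twice the indicator that both lie outside, minus 1.\<close>

lemma rad_quad_eq:
  assumes "finite J" "T \<subseteq> J"
  shows "rad_quad a J T = 2 * (\<Sum>i\<in>T. \<Sum>j\<in>T - {i}. a i j)
    + 2 * (\<Sum>i\<in>J - T. \<Sum>j\<in>J - T - {i}. a i j) - (\<Sum>i\<in>J. \<Sum>j\<in>J - {i}. a i j)"
proof -
  have restrict: "(\<Sum>i\<in>J. \<Sum>j\<in>J - {i}. if i \<in> S \<and> j \<in> S then a i j else 0) = (\<Sum>i\<in>S. \<Sum>j\<in>S - {i}. a i j)"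
    if "S \<subseteq> J" for S
  proof -
    have "(\<Sum>j\<in>J - {i}. if i \<in> S \<and> j \<in> S then a i j else 0) = (\<Sum>j\<in>S - {i}. a i j)" if "i \<in> S" for i
      using assms(1) \<open>S \<subseteq> J\<close> that by (intro sum.mono_neutral_cong_right) auto
    then show ?thesis
      using assms(1) that by (intro sum.mono_neutral_cong_right) auto
  qed
  have "rad_quad a J T = (\<Sum>i\<in>J. \<Sum>j\<in>J - {i}. 2 * (if i \<in> T \<and> j \<in> T then a i j else 0)
      + 2 * (if i \<in> J - T \<and> j \<in> J - T then a i j else 0) - a i j)"
    unfolding rad_quad_def by (intro sum.cong refl) (auto simp: sign_of_def)
  then show ?thesis
    using restrict[of T] restrict[of "J - T"] assms(2)
    by (simp add: sum.distrib sum_subtractf sum_distrib_left[symmetric])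
qed

section \<open>Integrating product measures one coordinate at a time\<close>

context prob_space
begin

lemma nn_integral_PiM_insert:
  assumes "finite I" "i \<in> I" "f \<in> borel_measurable (PiM I (\<lambda>_. M))"
  shows "(\<integral>\<^sup>+x. f x \<partial>PiM I (\<lambda>_. M)) = (\<integral>\<^sup>+x. \<integral>\<^sup>+y. f (x(i := y)) \<partial>M \<partial>PiM (I - {i}) (\<lambda>_. M))"
proof -
  interpret product_sigma_finite "\<lambda>_. M" by unfold_locales
  show ?thesis
    using product_nn_integral_insert[of "I - {i}" i f] assms by (simp add: insert_absorb)
qed

text \<open>Coordinate \<open>j\<close> is integrated first. Since \<open>p\<close> bounds the inner
  integral uniformly in \<open>u\<close>, it does not matter how \<open>F\<close> depends on the
  coordinate \<open>i\<close>.\<close>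

lemma nn_integral_PiM_pair_le:
  fixes F :: "('i \<Rightarrow> 'a) \<Rightarrow> ennreal"
  assumes I: "finite I" "i \<in> I" "j \<in> I" "i \<noteq> j"
    and F: "F \<in> borel_measurable (PiM I (\<lambda>_. M))" "\<And>x y. F (x(j := y)) = F x"
    and f[measurable]: "case_prod f \<in> borel_measurable (M \<Otimes>\<^sub>M M)"
    and p: "\<And>u. u \<in> space M \<Longrightarrow> (\<integral>\<^sup>+y. f u y \<partial>M) \<le> p"
  shows "(\<integral>\<^sup>+x. F x * f (x i) (x j) \<partial>PiM I (\<lambda>_. M)) \<le> (\<integral>\<^sup>+x. F x \<partial>PiM I (\<lambda>_. M)) * p"
proof -
  have "(\<lambda>x. case_prod f (x i, x j)) \<in> borel_measurable (PiM I (\<lambda>_. M))"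
    using I by (intro measurable_compose[OF _ f]) (auto intro!: measurable_Pair measurable_component_singleton)
  then have m: "(\<lambda>x. F x * f (x i) (x j)) \<in> borel_measurable (PiM I (\<lambda>_. M))"
    using F(1) by simp
  have "(\<integral>\<^sup>+x. F x * f (x i) (x j) \<partial>PiM I (\<lambda>_. M))
      = (\<integral>\<^sup>+x. \<integral>\<^sup>+y. F x * f (x i) y \<partial>M \<partial>PiM (I - {j}) (\<lambda>_. M))"
    using I(4) by (subst nn_integral_PiM_insert[OF I(1,3) m]) (simp add: F(2))
  also have "\<dots> \<le> (\<integral>\<^sup>+x. \<integral>\<^sup>+y. F x * p \<partial>M \<partial>PiM (I - {j}) (\<lambda>_. M))"
  proof (rule nn_integral_mono)
    fix x assume "x \<in> space (PiM (I - {j}) (\<lambda>_. M))"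
    then have x: "x i \<in> space M" using I by (auto simp: space_PiM)
    have "(\<lambda>y. case_prod f (x i, y)) \<in> borel_measurable M"
      using x by (intro measurable_compose[OF measurable_Pair1' f])
    then show "(\<integral>\<^sup>+y. F x * f (x i) y \<partial>M) \<le> (\<integral>\<^sup>+y. F x * p \<partial>M)"
      using p[OF x] by (simp add: nn_integral_cmult emeasure_space_1 mult_left_mono)
  qed
  also have "\<dots> = (\<integral>\<^sup>+x. F x * p \<partial>PiM I (\<lambda>_. M))"
    using F by (subst nn_integral_PiM_insert[OF I(1,3)]) simp_all
  also have "\<dots> = (\<integral>\<^sup>+x. F x \<partial>PiM I (\<lambda>_. M)) * p"
    using F(1) by (rule nn_integral_multc)
  finally show ?thesis .
qed

lemma nn_integral_PiM_pair:
  assumes I: "finite I" "i \<in> I" "j \<in> I" "i \<noteq> j"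
    and f[measurable]: "case_prod f \<in> borel_measurable (M \<Otimes>\<^sub>M M)"
  shows "(\<integral>\<^sup>+x. f (x i) (x j) \<partial>PiM I (\<lambda>_. M)) = (\<integral>\<^sup>+u. \<integral>\<^sup>+y. f u y \<partial>M \<partial>M)"
proof -
  have m: "(\<lambda>x. case_prod f (x i, x j)) \<in> borel_measurable (PiM I (\<lambda>_. M))"
    using I by (intro measurable_compose[OF _ f]) (auto intro!: measurable_Pair measurable_component_singleton)
  have "(\<integral>\<^sup>+x. f (x i) (x j) \<partial>PiM I (\<lambda>_. M)) = (\<integral>\<^sup>+x. \<integral>\<^sup>+y. f (x i) y \<partial>M \<partial>PiM (I - {j}) (\<lambda>_. M))"
    using I(4) m by (subst nn_integral_PiM_insert[OF I(1,3)]) simp_all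
  also have "\<dots> = (\<integral>\<^sup>+u. \<integral>\<^sup>+y. f u y \<partial>M \<partial>distr (PiM (I - {j}) (\<lambda>_. M)) M (\<lambda>x. x i))"
    using I by (subst nn_integral_distr) auto
  also have "distr (PiM (I - {j}) (\<lambda>_. M)) M (\<lambda>x. x i) = M"
    using I by (intro distr_PiM_component) (auto intro: prob_space_axioms)
  finally show ?thesis .
qed

lemma nn_integral_PiM_pair_bound:
  assumes I: "finite I" "i \<in> I" "j \<in> I" "i \<noteq> j"
    and f[measurable]: "case_prod f \<in> borel_measurable (M \<Otimes>\<^sub>M M)"
    and p: "\<And>u. u \<in> space M \<Longrightarrow> (\<integral>\<^sup>+y. f u y \<partial>M) \<le> p"
  shows "(\<integral>\<^sup>+x. f (x i) (x j) \<partial>PiM I (\<lambda>_. M)) \<le> p"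
proof -
  interpret P: prob_space "PiM I (\<lambda>_. M)" by (intro prob_space_PiM prob_space_axioms)
  show ?thesis
    using nn_integral_PiM_pair_le[OF I, of "\<lambda>_. 1" f p] p by (simp add: P.emeasure_space_1)
qed

end

locale degenerate_kernel = prob_space M for M :: "'a measure" +
  fixes k :: "'a \<Rightarrow> 'a \<Rightarrow> real" and B :: real
  assumes kernel_measurable: "case_prod k \<in> borel_measurable (M \<Otimes>\<^sub>M M)"
    and kernel_sym: "k x y = k y x"
    and kernel_bound: "x \<in> space M \<Longrightarrow> (\<integral>\<^sup>+y. \<bar>k x y\<bar> \<partial>M) \<le> ennreal B"
    and kernel_mean: "x \<in> space M \<Longrightarrow> (\<integral>y. k x y \<partial>M) = 0"
begin

lemma kernel_integrable: "x \<in> space M \<Longrightarrow> integrable M (k x)"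
proof (rule integrableI_bounded)
  assume x: "x \<in> space M"
  have "(\<lambda>y. case_prod k (x, y)) \<in> borel_measurable M"
    using x by (intro measurable_compose[OF measurable_Pair1' kernel_measurable])
  then show "k x \<in> borel_measurable M" by simp
  show "(\<integral>\<^sup>+y. ennreal (norm (k x y)) \<partial>M) < \<infinity>"
    using kernel_bound[OF x] by (simp add: order_le_less_trans[OF _ ennreal_less_top])
qed

lemma measurable_abs_kernel: "case_prod (\<lambda>x y. ennreal \<bar>k x y\<bar>) \<in> borel_measurable (M \<Otimes>\<^sub>M M)"
proof -
  have "(\<lambda>z. ennreal \<bar>case_prod k z\<bar>) \<in> borel_measurable (M \<Otimes>\<^sub>M M)"
    using kernel_measurable by measurable
  then show ?thesis by (simp add: case_prod_beta')
qed

lemma integrable_kernel_pair: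
  assumes "finite I" "i \<in> I" "j \<in> I" "i \<noteq> j"
  shows "integrable (PiM I (\<lambda>_. M)) (\<lambda>x. k (x i) (x j))"
proof (rule integrableI_bounded)
  have "(\<lambda>x. case_prod k (x i, x j)) \<in> borel_measurable (PiM I (\<lambda>_. M))"
    using assms by (intro measurable_compose[OF _ kernel_measurable])
      (auto intro!: measurable_Pair measurable_component_singleton)
  then show "(\<lambda>x. k (x i) (x j)) \<in> borel_measurable (PiM I (\<lambda>_. M))" by simp
  have "(\<integral>\<^sup>+x. \<bar>k (x i) (x j)\<bar> \<partial>PiM I (\<lambda>_. M)) \<le> ennreal B"
    using nn_integral_PiM_pair_bound[OF assms measurable_abs_kernel, OF kernel_bound] .
  then show "(\<integral>\<^sup>+x. ennreal (norm (k (x i) (x j))) \<partial>PiM I (\<lambda>_. M)) < \<infinity>"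
    by (simp add: order_le_less_trans[OF _ ennreal_less_top])
qed

lemma integrable_pair_sum:
  assumes "finite I"
  shows "integrable (PiM I (\<lambda>_. M)) (pair_sum k I)"
  unfolding pair_sum_def using assms
  by (intro Bochner_Integration.integrable_sum integrable_kernel_pair) auto

lemma integral_pair_sum:
  assumes "finite I"
  shows "(\<integral>x. pair_sum k I x \<partial>PiM I (\<lambda>_. M)) = 0"
proof -
  interpret product_sigma_finite "\<lambda>_. M" by unfold_locales
  have "(\<integral>x. k (x i) (x j) \<partial>PiM I (\<lambda>_. M)) = 0" if ij: "i \<in> I" "j \<in> I - {i}" for i j
  proof -
    have ij': "i \<in> I" "j \<in> I" "i \<noteq> j" using ij by auto
    have "insert j (I - {j}) = I" using ij by auto
    then have "(\<integral>x. k (x i) (x j) \<partial>PiM I (\<lambda>_. M)) = (\<integral>x. \<integral>y. k (x i) y \<partial>M \<partial>PiM (I - {j}) (\<lambda>_. M))"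
      using product_integral_insert[of "I - {j}" j "\<lambda>x. k (x i) (x j)"] assms ij'
        integrable_kernel_pair[OF assms ij'] by simp
    also have "\<dots> = (\<integral>x. 0 \<partial>PiM (I - {j}) (\<lambda>_. M))"
      using ij' by (intro Bochner_Integration.integral_cong refl kernel_mean) (auto simp: space_PiM)
    finally show ?thesis by simp
  qed
  then have "(\<Sum>i\<in>I. \<Sum>j\<in>I - {i}. \<integral>x. k (x i) (x j) \<partial>PiM I (\<lambda>_. M)) = 0"
    by simp
  moreover have "(\<integral>x. (\<Sum>i\<in>I. \<Sum>j\<in>I - {i}. k (x i) (x j)) \<partial>PiM I (\<lambda>_. M))
      = (\<Sum>i\<in>I. \<integral>x. (\<Sum>j\<in>I - {i}. k (x i) (x j)) \<partial>PiM I (\<lambda>_. M))"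
    using assms
    by (intro Bochner_Integration.integral_sum Bochner_Integration.integrable_sum integrable_kernel_pair) auto
  moreover have "\<dots> = (\<Sum>i\<in>I. \<Sum>j\<in>I - {i}. \<integral>x. k (x i) (x j) \<partial>PiM I (\<lambda>_. M))"
    using assms
    by (intro sum.cong refl Bochner_Integration.integral_sum integrable_kernel_pair) auto
  ultimately show ?thesis unfolding pair_sum_def by simp
qed

text \<open>By degeneracy, the sum over \<open>J\<close> is the conditional expectation of the sum over
  \<open>insert b J\<close> given the coordinates other than \<open>b\<close>.\<close>

lemma nn_integral_pair_sum_insert_mono:
  assumes I: "finite I" "insert b J \<subseteq> I" "b \<notin> J"
  shows "(\<integral>\<^sup>+x. \<bar>pair_sum k J x\<bar> \<partial>PiM I (\<lambda>_. M)) \<le> (\<integral>\<^sup>+x. \<bar>pair_sum k (insert b J) x\<bar> \<partial>PiM I (\<lambda>_. M))"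
proof -
  have fJ: "finite J" and b: "b \<in> I" and JI: "J \<subseteq> I" using I by (auto intro: finite_subset)
  have m: "(\<lambda>x. ennreal \<bar>pair_sum k S x\<bar>) \<in> borel_measurable (PiM I (\<lambda>_. M))" if "S \<subseteq> I" for S
    using measurable_pair_sum[OF kernel_measurable that] by measurable
  have "(\<integral>\<^sup>+x. \<bar>pair_sum k J x\<bar> \<partial>PiM I (\<lambda>_. M))
      = (\<integral>\<^sup>+x. ennreal \<bar>pair_sum k J x\<bar> \<partial>PiM (I - {b}) (\<lambda>_. M))"
    by (subst nn_integral_PiM_insert[OF I(1) b m[OF JI]])
       (simp add: pair_sum_fun_upd[OF I(3)] emeasure_space_1)
  also have "\<dots> \<le> (\<integral>\<^sup>+x. \<integral>\<^sup>+y. ennreal \<bar>pair_sum k (insert b J) (x(b := y))\<bar> \<partial>M \<partial>PiM (I - {b}) (\<lambda>_. M))"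
  proof (rule nn_integral_mono)
    fix x assume x: "x \<in> space (PiM (I - {b}) (\<lambda>_. M))"
    have xi: "x i \<in> space M" if "i \<in> J" for i using x that I by (auto simp: space_PiM)
    have eq: "pair_sum k (insert b J) (x(b := y)) = pair_sum k J x + (\<Sum>i\<in>J. 2 * k (x i) y)" for y
    proof -
      have "(\<Sum>i\<in>J. k ((x(b := y)) i) ((x(b := y)) b) + k ((x(b := y)) b) ((x(b := y)) i))
         = (\<Sum>i\<in>J. 2 * k (x i) y)"
      proof (rule sum.cong[OF refl])
        fix i assume "i \<in> J"
        then have "i \<noteq> b" using I(3) by auto
        then show "k ((x(b := y)) i) ((x(b := y)) b) + k ((x(b := y)) b) ((x(b := y)) i) = 2 * k (x i) y"
          using kernel_sym[of y "x i"] by simp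
      qed
      then show ?thesis
        using pair_sum_fun_upd[OF I(3), of k x y]
        unfolding pair_sum_def sum_offdiag_insert[OF fJ I(3)] by simp
    qed
    have int: "integrable M (\<lambda>y. pair_sum k J x + (\<Sum>i\<in>J. 2 * k (x i) y))"
      using xi kernel_integrable by (intro Bochner_Integration.integrable_add Bochner_Integration.integrable_sum) auto
    \<comment> \<open>Degeneracy removes every term that contains \<open>y\<close>; the triangle
      inequality for integrals then acts as a conditional Jensen inequality.\<close>
    have "(\<integral>y. pair_sum k J x + (\<Sum>i\<in>J. 2 * k (x i) y) \<partial>M) = pair_sum k J x"
      using xi kernel_integrable kernel_mean
      by (subst Bochner_Integration.integral_add)
         (auto simp: prob_space Bochner_Integration.integral_sum intro!: Bochner_Integration.integrable_sum)
    then show "ennreal \<bar>pair_sum k J x\<bar> \<le> (\<integral>\<^sup>+y. ennreal \<bar>pair_sum k (insert b J) (x(b := y))\<bar> \<partial>M)"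
      using integral_norm_bound_ennreal[OF int] by (simp add: eq)
  qed
  also have "\<dots> = (\<integral>\<^sup>+x. \<bar>pair_sum k (insert b J) x\<bar> \<partial>PiM I (\<lambda>_. M))"
    using nn_integral_PiM_insert[OF I(1) b m[OF I(2)]] by simp
  finally show ?thesis .
qed

lemma nn_integral_pair_sum_mono:
  assumes "finite I" "J \<subseteq> I"
  shows "(\<integral>\<^sup>+x. \<bar>pair_sum k J x\<bar> \<partial>PiM I (\<lambda>_. M)) \<le> (\<integral>\<^sup>+x. \<bar>pair_sum k I x\<bar> \<partial>PiM I (\<lambda>_. M))"
proof -
  have "(\<integral>\<^sup>+x. \<bar>pair_sum k J x\<bar> \<partial>PiM I (\<lambda>_. M)) \<le> (\<integral>\<^sup>+x. \<bar>pair_sum k (J \<union> D) x\<bar> \<partial>PiM I (\<lambda>_. M))"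
    if "finite D" "D \<subseteq> I - J" for D
    using that
  proof (induction D rule: finite_induct)
    case (insert b D)
    then have "(\<integral>\<^sup>+x. \<bar>pair_sum k (J \<union> D) x\<bar> \<partial>PiM I (\<lambda>_. M))
        \<le> (\<integral>\<^sup>+x. \<bar>pair_sum k (insert b (J \<union> D)) x\<bar> \<partial>PiM I (\<lambda>_. M))"
      using assms by (intro nn_integral_pair_sum_insert_mono) auto
    then show ?case using insert by auto
  qed simp
  from this[of "I - J"] show ?thesis using assms by (simp add: Un_absorb1)
qed

text \<open>By \<open>rad_quad_eq\<close> the signed sum is a combination of the unsigned sums over
  \<open>T\<close>, its complement and \<open>I\<close>. Each of these is dominated in mean by the
  full sum, and 5 = 2 + 2 + 1.\<close>

lemma nn_integral_signed_pair_sum_le: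
  assumes "finite I" "T \<subseteq> I"
  shows "(\<integral>\<^sup>+x. \<bar>rad_quad (\<lambda>i j. k (x i) (x j)) I T\<bar> \<partial>PiM I (\<lambda>_. M))
    \<le> 5 * (\<integral>\<^sup>+x. \<bar>pair_sum k I x\<bar> \<partial>PiM I (\<lambda>_. M))"
proof -
  let ?A = "\<lambda>S. \<integral>\<^sup>+x. ennreal \<bar>pair_sum k S x\<bar> \<partial>PiM I (\<lambda>_. M)"
  note [measurable] = measurable_pair_sum[OF kernel_measurable, of T I]
    measurable_pair_sum[OF kernel_measurable, of "I - T" I] measurable_pair_sum[OF kernel_measurable, of I I]
  note [simp] = \<open>T \<subseteq> I\<close>
  have "(\<integral>\<^sup>+x. \<bar>rad_quad (\<lambda>i j. k (x i) (x j)) I T\<bar> \<partial>PiM I (\<lambda>_. M))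
     \<le> (\<integral>\<^sup>+x. 2 * ennreal \<bar>pair_sum k T x\<bar> + 2 * ennreal \<bar>pair_sum k (I - T) x\<bar> + ennreal \<bar>pair_sum k I x\<bar> \<partial>PiM I (\<lambda>_. M))"
  proof (rule nn_integral_mono)
    fix x
    have "\<bar>rad_quad (\<lambda>i j. k (x i) (x j)) I T\<bar>
       \<le> 2 * \<bar>pair_sum k T x\<bar> + 2 * \<bar>pair_sum k (I - T) x\<bar> + \<bar>pair_sum k I x\<bar>"
    proof -
      have "rad_quad (\<lambda>i j. k (x i) (x j)) I T
          = 2 * pair_sum k T x + 2 * pair_sum k (I - T) x - pair_sum k I x"
        unfolding rad_quad_eq[OF assms] pair_sum_def ..
      then show ?thesis by linarith
    qed
    then have "ennreal \<bar>rad_quad (\<lambda>i j. k (x i) (x j)) I T\<bar>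
       \<le> ennreal (2 * \<bar>pair_sum k T x\<bar> + 2 * \<bar>pair_sum k (I - T) x\<bar> + \<bar>pair_sum k I x\<bar>)"
      by (rule ennreal_leI)
    then show "ennreal \<bar>rad_quad (\<lambda>i j. k (x i) (x j)) I T\<bar>
       \<le> 2 * ennreal \<bar>pair_sum k T x\<bar> + 2 * ennreal \<bar>pair_sum k (I - T) x\<bar> + ennreal \<bar>pair_sum k I x\<bar>"
      by (simp add: ennreal_plus ennreal_mult)
  qed
  also have "\<dots> = 2 * ?A T + 2 * ?A (I - T) + ?A I"
    by (simp add: nn_integral_add nn_integral_cmult)
  also have "\<dots> \<le> 2 * ?A I + 2 * ?A I + ?A I"
    using assms by (intro add_mono mult_left_mono nn_integral_pair_sum_mono) auto
  also have "\<dots> = (2 + 2 + 1) * ?A I"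
    by (simp only: distrib_right mult_1_left)
  also have "\<dots> = 5 * ?A I"
    by simp
  finally show ?thesis .
qed

text \<open>The bound \<open>rad_quad_abs_ge\<close> is applied for each fixed configuration and the
  sign patterns are then averaged; 150 = 30 * 5. No integrability of k^2 enters.\<close>

lemma nn_integral_pair_sum_ge_square_function:
  assumes "finite I"
  shows "(\<integral>\<^sup>+x. sqrt (pair_sum (\<lambda>u v. k u v ^ 2) I x) \<partial>PiM I (\<lambda>_. M))
    \<le> 150 * (\<integral>\<^sup>+x. \<bar>pair_sum k I x\<bar> \<partial>PiM I (\<lambda>_. M))"
proof -
  let ?n = "2 ^ card I :: real"
  let ?q = "\<lambda>T x. rad_quad (\<lambda>i j. k (x i) (x j)) I T"
  let ?A = "\<integral>\<^sup>+x. ennreal \<bar>pair_sum k I x\<bar> \<partial>PiM I (\<lambda>_. M)"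
  have q: "(\<lambda>x. ennreal \<bar>?q T x\<bar>) \<in> borel_measurable (PiM I (\<lambda>_. M))" if "T \<in> Pow I" for T
  proof -
    have T: "T \<subseteq> I" using that by simp
    note [measurable] = measurable_pair_sum[OF kernel_measurable T]
      measurable_pair_sum[OF kernel_measurable Diff_subset[of I T]]
      measurable_pair_sum[OF kernel_measurable order_refl, of I]
    show ?thesis
      unfolding rad_quad_eq[OF assms T] pair_sum_def[symmetric] by measurable
  qed
  have "(\<integral>\<^sup>+x. sqrt (pair_sum (\<lambda>u v. k u v ^ 2) I x) \<partial>PiM I (\<lambda>_. M))
      \<le> (\<integral>\<^sup>+x. (\<Sum>T\<in>Pow I. ennreal (30 / ?n) * ennreal \<bar>?q T x\<bar>) \<partial>PiM I (\<lambda>_. M))"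
  proof (rule nn_integral_mono)
    fix x
    have "?n * (sqrt (pair_sum (\<lambda>u v. k u v ^ 2) I x) / 30) \<le> (\<Sum>T\<in>Pow I. \<bar>?q T x\<bar>)"
      unfolding pair_sum_def by (rule rad_quad_abs_ge[OF assms]) (rule kernel_sym)
    then have "sqrt (pair_sum (\<lambda>u v. k u v ^ 2) I x) \<le> 30 / ?n * (\<Sum>T\<in>Pow I. \<bar>?q T x\<bar>)"
      by (simp add: field_simps)
    also have "\<dots> = (\<Sum>T\<in>Pow I. 30 / ?n * \<bar>?q T x\<bar>)"
      by (rule sum_distrib_left)
    finally have "ennreal (sqrt (pair_sum (\<lambda>u v. k u v ^ 2) I x)) \<le> ennreal (\<Sum>T\<in>Pow I. 30 / ?n * \<bar>?q T x\<bar>)"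
      by (rule ennreal_leI)
    also have "\<dots> = (\<Sum>T\<in>Pow I. ennreal (30 / ?n) * ennreal \<bar>?q T x\<bar>)"
      by (subst sum_ennreal[symmetric]) (auto simp: ennreal_mult' simp del: times_divide_eq_left intro!: sum.cong)
    finally show "ennreal (sqrt (pair_sum (\<lambda>u v. k u v ^ 2) I x))
        \<le> (\<Sum>T\<in>Pow I. ennreal (30 / ?n) * ennreal \<bar>?q T x\<bar>)" .
  qed
  also have "\<dots> = (\<Sum>T\<in>Pow I. ennreal (30 / ?n) * (\<integral>\<^sup>+x. \<bar>?q T x\<bar> \<partial>PiM I (\<lambda>_. M)))"
    using q by (subst nn_integral_sum) (auto simp: nn_integral_cmult intro!: sum.cong)
  also have "\<dots> \<le> (\<Sum>T\<in>Pow I. ennreal (30 / ?n) * (5 * ?A))"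
    using assms by (intro sum_mono mult_left_mono nn_integral_signed_pair_sum_le) auto
  also have "\<dots> = (ennreal ?n * ennreal (30 / ?n)) * (5 * ?A)"
    using assms by (simp add: card_Pow mult.assoc ennreal_power[symmetric])
  also have "ennreal ?n * ennreal (30 / ?n) = 30"
    by (simp add: ennreal_mult[symmetric])
  also have "30 * (5 * ?A) = 150 * ?A"
    by (simp add: mult.assoc[symmetric])
  finally show ?thesis .
qed

end

section \<open>Two moments of a truncated square function\<close>

context degenerate_kernel
begin

text \<open>The square is expanded over two ordered pairs \<open>d\<close> and \<open>e\<close>. If
  one endpoint of \<open>d\<close> is absent from \<open>e\<close>, integrating that coordinate
  first gives p^2, even if the other endpoint is shared. Otherwise the pairs coincide up to order,
  and \<phi>^2 <= b \<phi> gives b p; each \<open>d\<close> has two such partners.\<close>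

lemma nn_integral_pair_sum_square_le:
  fixes \<phi> :: "'a \<Rightarrow> 'a \<Rightarrow> real" and I :: "'i set"
  assumes I: "finite I" and bp: "b \<ge> 0" "p \<ge> 0"
    and meas: "case_prod \<phi> \<in> borel_measurable (M \<Otimes>\<^sub>M M)"
    and \<phi>: "\<And>u v. 0 \<le> \<phi> u v" "\<And>u v. \<phi> u v = \<phi> v u" "\<And>u v. \<phi> u v \<le> b"
    and p: "\<And>u. u \<in> space M \<Longrightarrow> (\<integral>\<^sup>+v. \<phi> u v \<partial>M) \<le> ennreal p"
  shows "(\<integral>\<^sup>+x. (pair_sum \<phi> I x)\<^sup>2 \<partial>PiM I (\<lambda>_. M))
    \<le> ennreal (real (card I) ^ 4 * p\<^sup>2 + 2 * (real (card I))\<^sup>2 * (b * p))"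
proof -
  let ?P = "PiM I (\<lambda>_. M)"
  define D where "D = Sigma I (\<lambda>i. I - {i})"
  define f where "f = (\<lambda>(d :: 'i \<times> 'i) x. \<phi> (x (fst d)) (x (snd d)))"
  have D: "fst d \<in> I" "snd d \<in> I" "fst d \<noteq> snd d" if "d \<in> D" for d
    using that by (auto simp: D_def)
  have fD: "finite D" using I by (simp add: D_def)
  have meas': "case_prod (\<lambda>u v. ennreal (\<phi> u v)) \<in> borel_measurable (M \<Otimes>\<^sub>M M)"
  proof -
    have "(\<lambda>z. ennreal (case_prod \<phi> z)) \<in> borel_measurable (M \<Otimes>\<^sub>M M)"
      using meas by measurable
    then show ?thesis by (simp add: case_prod_beta')
  qed
  have fm: "(\<lambda>x. \<phi> (x i) (x j)) \<in> borel_measurable ?P" if "i \<in> I" "j \<in> I" for i j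
  proof -
    have "(\<lambda>x. case_prod \<phi> (x i, x j)) \<in> borel_measurable ?P"
      using that by (intro measurable_compose[OF _ meas])
        (auto intro!: measurable_Pair measurable_component_singleton)
    then show ?thesis by simp
  qed
  have mean: "(\<integral>\<^sup>+x. \<phi> (x i) (x j) \<partial>?P) \<le> ennreal p" if "i \<in> I" "j \<in> I" "i \<noteq> j" for i j
    using nn_integral_PiM_pair_bound[OF I that meas' p] .
  have free: "(\<integral>\<^sup>+x. \<phi> (x i) (x j) * \<phi> (x k) (x l) \<partial>?P) \<le> ennreal (p * p)"
    if "i \<in> I" "j \<in> I" "i \<noteq> j" "k \<in> I" "l \<in> I" "k \<noteq> l" "j \<noteq> k" "j \<noteq> l" for i j k l
  proof -
    have "(\<integral>\<^sup>+x. \<phi> (x i) (x j) * \<phi> (x k) (x l) \<partial>?P)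
        = (\<integral>\<^sup>+x. ennreal (\<phi> (x k) (x l)) * ennreal (\<phi> (x i) (x j)) \<partial>?P)"
      by (simp add: ennreal_mult[symmetric] \<phi>(1) mult.commute)
    also have "\<dots> \<le> (\<integral>\<^sup>+x. \<phi> (x k) (x l) \<partial>?P) * ennreal p"
      using that fm by (intro nn_integral_PiM_pair_le[OF I that(1-3) _ _ meas' p]) auto
    also have "\<dots> \<le> ennreal p * ennreal p"
      using mean that by (intro mult_right_mono) auto
    finally show ?thesis using bp by (simp add: ennreal_mult)
  qed
  have pair: "(\<integral>\<^sup>+x. f d x * f e x \<partial>?P)
      \<le> ennreal (p * p + (if e = d then b * p else 0) + (if e = prod.swap d then b * p else 0))"
    if d: "d \<in> D" and e: "e \<in> D" for d e
  proof -
    have mono: "ennreal (p * p) \<le> ennreal (p * p + (if e = d then b * p else 0) + (if e = prod.swap d then b * p else 0))"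
      using bp by (intro ennreal_leI) auto
    \<comment> \<open>When both endpoints of \<open>d\<close> occur in \<open>e\<close>,
      distinctness of the endpoints forces \<open>e\<close> to be \<open>d\<close> or its
      reversal.\<close>
    consider "snd d \<noteq> fst e" "snd d \<noteq> snd e" | "fst d \<noteq> fst e" "fst d \<noteq> snd e"
      | "e = d \<or> e = prod.swap d"
      using D[OF d] D[OF e] by (cases d; cases e) auto
    then show ?thesis
    proof cases
      case 1
      then show ?thesis
        using free[OF D[OF d] D[OF e]] mono unfolding f_def by (meson order_trans)
    next
      case 2
      have "fst d \<noteq> snd d" using D[OF d] by simp
      with 2 have "(\<integral>\<^sup>+x. \<phi> (x (snd d)) (x (fst d)) * \<phi> (x (fst e)) (x (snd e)) \<partial>?P) \<le> ennreal (p * p)"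
        using D[OF d] D[OF e] by (intro free) auto
      then show ?thesis
        using mono unfolding f_def \<phi>(2)[of "_ (fst d)"] by (meson order_trans)
    next
      case 3
      have "(\<integral>\<^sup>+x. f d x * f e x \<partial>?P) \<le> (\<integral>\<^sup>+x. ennreal b * ennreal (f d x) \<partial>?P)"
      proof (rule nn_integral_mono)
        fix x
        have "f d x * f e x \<le> f d x * b"
          using \<phi> by (intro mult_left_mono) (auto simp: f_def)
        then have "ennreal (f d x * f e x) \<le> ennreal (b * f d x)"
          by (intro ennreal_leI) (simp add: mult.commute)
        then show "ennreal (f d x * f e x) \<le> ennreal b * ennreal (f d x)"
          using bp \<phi>(1) by (simp add: ennreal_mult f_def)
      qed
      also have "\<dots> = ennreal b * (\<integral>\<^sup>+x. f d x \<partial>?P)"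
        using fm D[OF d] by (intro nn_integral_cmult) (auto simp: f_def)
      also have "\<dots> \<le> ennreal b * ennreal p"
        using mean D[OF d] by (intro mult_left_mono) (auto simp: f_def)
      also have "\<dots> = ennreal (b * p)"
        using bp by (simp add: ennreal_mult)
      also have "\<dots> \<le> ennreal (p * p + (if e = d then b * p else 0) + (if e = prod.swap d then b * p else 0))"
        using 3 bp by (intro ennreal_leI) auto
      finally show ?thesis .
    qed
  qed
  have Y: "pair_sum \<phi> I x = (\<Sum>d\<in>D. f d x)" for x
    using I unfolding pair_sum_def D_def f_def by (simp add: sum.Sigma case_prod_beta')
  have "(\<integral>\<^sup>+x. (pair_sum \<phi> I x)\<^sup>2 \<partial>?P) = (\<integral>\<^sup>+x. (\<Sum>d\<in>D. \<Sum>e\<in>D. ennreal (f d x * f e x)) \<partial>?P)"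
    unfolding Y power2_eq_square sum_product
    using \<phi>(1) by (intro nn_integral_cong) (simp add: sum_ennreal sum_nonneg f_def)
  also have "\<dots> = (\<Sum>d\<in>D. \<Sum>e\<in>D. \<integral>\<^sup>+x. f d x * f e x \<partial>?P)"
    using D fm by (subst nn_integral_sum) (auto intro!: sum.cong simp: nn_integral_sum f_def)
  also have "\<dots> \<le> (\<Sum>d\<in>D. \<Sum>e\<in>D. ennreal (p * p + (if e = d then b * p else 0) + (if e = prod.swap d then b * p else 0)))"
    using pair by (intro sum_mono) auto
  also have "\<dots> = ennreal (\<Sum>d\<in>D. \<Sum>e\<in>D. p * p + (if e = d then b * p else 0) + (if e = prod.swap d then b * p else 0))"
    using bp by (simp add: sum_ennreal sum_nonneg del: ennreal_plus)
  also have "\<dots> \<le> ennreal (\<Sum>d\<in>D. real (card D) * (p * p) + b * p + b * p)"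
    using fD bp by (intro ennreal_leI sum_mono) (simp add: sum.distrib)
  also have "\<dots> = ennreal (real (card D) ^ 2 * p\<^sup>2 + 2 * real (card D) * (b * p))"
    by (simp add: power2_eq_square algebra_simps)
  also have "\<dots> \<le> ennreal ((real (card I) ^ 2) ^ 2 * p\<^sup>2 + 2 * (real (card I))\<^sup>2 * (b * p))"
  proof -
    have "card D \<le> card (I \<times> I)" using I by (intro card_mono) (auto simp: D_def)
    then have "real (card D) \<le> real (card I) ^ 2"
      by (simp add: card_cartesian_product power2_eq_square flip: of_nat_mult)
    then show ?thesis using bp by (intro ennreal_leI add_mono mult_right_mono mult_left_mono power_mono) auto
  qed
  finally show ?thesis by (simp add: power_mult[symmetric])
qed

text \<open>The kernel itself need not be square integrable; only the truncation \<open>\<phi>\<close> of its square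
  enters, and \<open>sqrt Y \<ge> Y / \<tau> - Y\<^sup>2 / \<tau>\<^sup>3\<close> turns the first two moments of
  \<open>Y = pair_sum \<phi> I\<close> into a lower bound for the mean of \<open>sqrt Y\<close>.\<close>

lemma abs_pair_sum_lower_bound:
  fixes \<phi> :: "'a \<Rightarrow> 'a \<Rightarrow> real" and I :: "'i set"
  assumes I: "finite I" "card I \<ge> 2"
    and meas: "case_prod \<phi> \<in> borel_measurable (M \<Otimes>\<^sub>M M)"
    and \<phi>: "\<And>u v. 0 \<le> \<phi> u v" "\<And>u v. \<phi> u v = \<phi> v u" "\<And>u v. \<phi> u v \<le> b"
    and le: "\<And>u v. \<phi> u v \<le> (k u v)\<^sup>2"
    and p: "\<And>u. u \<in> space M \<Longrightarrow> (\<integral>\<^sup>+v. \<phi> u v \<partial>M) \<le> ennreal p"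
    and m: "(\<integral>\<^sup>+u. \<integral>\<^sup>+v. \<phi> u v \<partial>M \<partial>M) \<ge> ennreal (\<eta> * p)"
    and pos: "\<eta> > 0" "p > 0" and b: "b \<le> (real (card I))\<^sup>2 * p"
  shows "(\<integral>x. \<bar>pair_sum k I x\<bar> \<partial>PiM I (\<lambda>_. M)) \<ge> \<eta> / (600 * sqrt (12 / \<eta>)) * real (card I) * sqrt p"
proof -
  let ?P = "PiM I (\<lambda>_. M)"
  let ?N = "real (card I)"
  \<comment> \<open>The scale \<tau> is a multiple of the square root of N^2 p. The gain is
    \<eta>/(2\<alpha>) and the loss 3/\<alpha>^3, both times N sqrt p; with \<alpha>^2 = 12/\<eta>
    the loss is exactly half of the gain. The remaining \<eta>/(4\<alpha>), divided by 150, is the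
    constant of the claim.\<close>
  define \<alpha> where "\<alpha> = sqrt (12 / \<eta>)"
  define \<tau> where "\<tau> = \<alpha> * ?N * sqrt p"
  have \<alpha>: "\<alpha> > 0" "\<alpha>\<^sup>2 = 12 / \<eta>" using pos by (auto simp: \<alpha>_def)
  have N: "?N \<ge> 2" using I by simp
  have \<tau>: "\<tau> > 0" using \<alpha> N pos by (simp add: \<tau>_def)
  have b0: "b \<ge> 0" using \<phi>(1,3) order_trans by blast
  have Y0: "pair_sum \<phi> I x \<ge> 0" for x unfolding pair_sum_def using \<phi>(1) by (intro sum_nonneg) auto
  have [measurable]: "pair_sum \<phi> I \<in> borel_measurable ?P"
    using measurable_pair_sum[OF meas order_refl] .
  define A where "A = (\<integral>x. \<bar>pair_sum k I x\<bar> \<partial>?P)"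
  have A0: "A \<ge> 0" by (simp add: A_def)
  have A: "(\<integral>\<^sup>+x. \<bar>pair_sum k I x\<bar> \<partial>?P) = ennreal A"
    unfolding A_def by (rule nn_integral_eq_integral) (auto intro!: integrable_pair_sum I)
  have meas': "case_prod (\<lambda>u v. ennreal (\<phi> u v)) \<in> borel_measurable (M \<Otimes>\<^sub>M M)"
  proof -
    have "(\<lambda>z. ennreal (case_prod \<phi> z)) \<in> borel_measurable (M \<Otimes>\<^sub>M M)"
      using meas by measurable
    then show ?thesis by (simp add: case_prod_beta')
  qed
  have fm: "(\<lambda>x. ennreal (\<phi> (x i) (x j))) \<in> borel_measurable ?P" if "i \<in> I" "j \<in> I" for i j
  proof -
    have "(\<lambda>x. case_prod (\<lambda>u v. ennreal (\<phi> u v)) (x i, x j)) \<in> borel_measurable ?P"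
      using that by (intro measurable_compose[OF _ meas'])
        (auto intro!: measurable_Pair measurable_component_singleton)
    then show ?thesis by simp
  qed
  \<comment> \<open>There are N (N - 1) ordered pairs, at least N^2/2 because N >= 2.\<close>
  have "ennreal (?N\<^sup>2 / 2 * (\<eta> * p)) \<le> ennreal (?N * (?N - 1) * (\<eta> * p))"
    using N pos by (intro ennreal_leI mult_right_mono) (auto simp: power2_eq_square field_simps)
  also have "\<dots> = (\<Sum>i\<in>I. \<Sum>j\<in>I - {i}. ennreal (\<eta> * p))"
    using I N pos by (simp add: ennreal_of_nat_eq_real_of_nat ennreal_mult[symmetric] of_nat_diff mult_ac)
  also have "\<dots> \<le> (\<Sum>i\<in>I. \<Sum>j\<in>I - {i}. \<integral>\<^sup>+x. \<phi> (x i) (x j) \<partial>?P)"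
    using m by (intro sum_mono) (subst nn_integral_PiM_pair[OF I(1) _ _ _ meas'], auto)
  also have "\<dots> = (\<integral>\<^sup>+x. (\<Sum>i\<in>I. \<Sum>j\<in>I - {i}. ennreal (\<phi> (x i) (x j))) \<partial>?P)"
    using fm by (subst nn_integral_sum) (auto intro!: sum.cong nn_integral_sum[symmetric])
  also have "\<dots> = (\<integral>\<^sup>+x. pair_sum \<phi> I x \<partial>?P)"
    unfolding pair_sum_def using \<phi>(1) by (simp add: sum_ennreal sum_nonneg)
  finally have EY: "ennreal (?N\<^sup>2 / 2 * (\<eta> * p)) \<le> (\<integral>\<^sup>+x. pair_sum \<phi> I x \<partial>?P)" .
  have EY2: "(\<integral>\<^sup>+x. (pair_sum \<phi> I x)\<^sup>2 \<partial>?P) \<le> ennreal (3 * ?N ^ 4 * p\<^sup>2)"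
  proof -
    have "(\<integral>\<^sup>+x. (pair_sum \<phi> I x)\<^sup>2 \<partial>?P) \<le> ennreal (?N ^ 4 * p\<^sup>2 + 2 * ?N\<^sup>2 * (b * p))"
      using pos b0 by (intro nn_integral_pair_sum_square_le I meas \<phi> p) auto
    \<comment> \<open>The hypothesis on \<open>b\<close> enters here: it keeps the contribution of
      coinciding pairs within a constant of the square of the mean.\<close>
    also have "\<dots> \<le> ennreal (?N ^ 4 * p\<^sup>2 + 2 * ?N\<^sup>2 * ((?N\<^sup>2 * p) * p))"
      using b pos by (intro ennreal_leI add_mono mult_left_mono mult_right_mono) auto
    also have "\<dots> = ennreal (3 * ?N ^ 4 * p\<^sup>2)"
      by (simp add: power2_eq_square power4_eq_xxxx algebra_simps)
    finally show ?thesis .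
  qed
  have "ennreal (1 / \<tau>) * ennreal (?N\<^sup>2 / 2 * (\<eta> * p)) \<le> ennreal (1 / \<tau>) * (\<integral>\<^sup>+x. pair_sum \<phi> I x \<partial>?P)"
    by (intro mult_left_mono EY) auto
  also have "\<dots> = (\<integral>\<^sup>+x. ennreal (1 / \<tau>) * pair_sum \<phi> I x \<partial>?P)"
    by (simp add: nn_integral_cmult)
  also have "\<dots> \<le> (\<integral>\<^sup>+x. ennreal (sqrt (pair_sum (\<lambda>u v. (k u v)\<^sup>2) I x))
       + ennreal (1 / \<tau> ^ 3) * ennreal ((pair_sum \<phi> I x)\<^sup>2) \<partial>?P)"
  proof (rule nn_integral_mono)
    fix x
    let ?Y = "pair_sum \<phi> I x"
    have "?Y \<le> pair_sum (\<lambda>u v. (k u v)\<^sup>2) I x"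
      unfolding pair_sum_def by (intro sum_mono le)
    then have "sqrt ?Y \<le> sqrt (pair_sum (\<lambda>u v. (k u v)\<^sup>2) I x)" by simp
    moreover have "?Y / \<tau> - ?Y\<^sup>2 / \<tau> ^ 3 \<le> sqrt ?Y"
    proof -
      have "(sqrt ?Y)\<^sup>2 = ?Y" "sqrt ?Y ^ 4 = ?Y\<^sup>2"
        using Y0[of x] by (simp_all add: power4_eq_xxxx power2_eq_square mult.assoc)
      then show ?thesis
        using abs_ge_interpolation[OF \<tau>, of "sqrt ?Y"] Y0[of x] by simp
    qed
    ultimately have "?Y / \<tau> \<le> sqrt (pair_sum (\<lambda>u v. (k u v)\<^sup>2) I x) + ?Y\<^sup>2 / \<tau> ^ 3"
      by linarith
    then have "1 / \<tau> * ?Y \<le> sqrt (pair_sum (\<lambda>u v. (k u v)\<^sup>2) I x) + 1 / \<tau> ^ 3 * ?Y\<^sup>2"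
      by simp
    then have "ennreal (1 / \<tau> * ?Y) \<le> ennreal (sqrt (pair_sum (\<lambda>u v. (k u v)\<^sup>2) I x) + 1 / \<tau> ^ 3 * ?Y\<^sup>2)"
      by (rule ennreal_leI)
    moreover have "sqrt (pair_sum (\<lambda>u v. (k u v)\<^sup>2) I x) \<ge> 0"
      by (auto simp: pair_sum_def intro!: sum_nonneg)
    ultimately show "ennreal (1 / \<tau>) * ennreal ?Y \<le> ennreal (sqrt (pair_sum (\<lambda>u v. (k u v)\<^sup>2) I x))
        + ennreal (1 / \<tau> ^ 3) * ennreal (?Y\<^sup>2)"
      using \<tau> Y0[of x] by (simp add: ennreal_mult ennreal_plus del: times_divide_eq_left)
  qed
  also have "\<dots> = (\<integral>\<^sup>+x. sqrt (pair_sum (\<lambda>u v. (k u v)\<^sup>2) I x) \<partial>?P)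
      + ennreal (1 / \<tau> ^ 3) * (\<integral>\<^sup>+x. (pair_sum \<phi> I x)\<^sup>2 \<partial>?P)"
  proof (subst nn_integral_add)
    have "(\<lambda>z. (case_prod k z)\<^sup>2) \<in> borel_measurable (M \<Otimes>\<^sub>M M)"
      using kernel_measurable by measurable
    then have "case_prod (\<lambda>u v. (k u v)\<^sup>2) \<in> borel_measurable (M \<Otimes>\<^sub>M M)"
      by (simp add: case_prod_beta')
    note [measurable] = measurable_pair_sum[OF this order_refl, of I]
    show "(\<lambda>x. ennreal (sqrt (pair_sum (\<lambda>u v. (k u v)\<^sup>2) I x))) \<in> borel_measurable ?P" by measurable
  qed (simp_all add: nn_integral_cmult)
  also have "\<dots> \<le> 150 * ennreal A + ennreal (1 / \<tau> ^ 3) * ennreal (3 * ?N ^ 4 * p\<^sup>2)"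
    using nn_integral_pair_sum_ge_square_function[OF I(1)] EY2 unfolding A
    by (intro add_mono mult_left_mono) auto
  also have "\<dots> = ennreal (150 * A + 1 / \<tau> ^ 3 * (3 * ?N ^ 4 * p\<^sup>2))"
    using \<tau> A0 by (simp add: ennreal_mult ennreal_plus del: times_divide_eq_left)
  finally have "1 / \<tau> * (?N\<^sup>2 / 2 * (\<eta> * p)) \<le> 150 * A + 1 / \<tau> ^ 3 * (3 * ?N ^ 4 * p\<^sup>2)"
    using \<tau> A0 pos by (simp add: ennreal_mult[symmetric] del: times_divide_eq_left ennreal_plus)
  moreover obtain r where r: "r > 0" "sqrt p = r" "p = r\<^sup>2"
    using pos by (metis real_sqrt_gt_zero real_sqrt_pow2 less_imp_le)
  have "1 / \<tau> * (?N\<^sup>2 / 2 * (\<eta> * p)) = \<eta> / (2 * \<alpha>) * ?N * sqrt p"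
    using \<alpha>(1) N r(1) unfolding \<tau>_def r(2) unfolding r(3) by (simp add: field_simps power2_eq_square)
  moreover have "1 / \<tau> ^ 3 * (3 * ?N ^ 4 * p\<^sup>2) = \<eta> / (4 * \<alpha>) * ?N * sqrt p"
  proof -
    have "\<alpha> ^ 3 = 12 / \<eta> * \<alpha>" using \<alpha>(2) by (simp add: power3_eq_cube power2_eq_square)
    then have "\<tau> ^ 3 = 12 / \<eta> * \<alpha> * ?N ^ 3 * r ^ 3"
      by (simp add: \<tau>_def r(2) power_mult_distrib)
    then have "1 / \<tau> ^ 3 * (3 * ?N ^ 4 * p\<^sup>2) = 1 / (12 / \<eta> * \<alpha> * ?N ^ 3 * r ^ 3) * (3 * ?N ^ 4 * (r\<^sup>2)\<^sup>2)"
      by (simp only: r(3))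
    then show ?thesis
      unfolding r(2) using \<alpha>(1) N pos r(1)
      by (simp add: field_simps power2_eq_square power3_eq_cube power4_eq_xxxx)
  qed
  ultimately have "\<eta> / (4 * \<alpha>) * ?N * sqrt p \<le> 150 * A"
    by (simp add: field_simps)
  then show ?thesis unfolding A_def[symmetric] \<alpha>_def[symmetric] by (simp add: field_simps)
qed

end

section \<open>Measures with bounded density\<close>

text \<open>On the shell with 2^(-n-1) <= |z| < 2^(-n) the n-th summand alone suffices, so singular
  integrals reduce to masses of balls. At the origin the left-hand side is 0 by the convention for
  \<open>powr\<close>.\<close>

lemma powr_minus_le_dyadic:
  fixes s :: real and z :: "'a :: real_normed_vector"
  assumes "s > 0"
  shows "ennreal (norm z powr (- s)) \<le> 1 + (\<Sum>n. ennreal (2 powr (s * real (Suc n))) * indicator (ball 0 (1 / 2 ^ n)) z)"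
proof -
  consider "z = 0" | "norm z \<ge> 1" | "z \<noteq> 0" "norm z < 1" by fastforce
  then show ?thesis
  proof cases
    case 1
    then show ?thesis by simp
  next
    case 2
    then have "norm z powr (- s) \<le> 1" using assms powr_mono[of "- s" 0 "norm z"] by (cases "z = 0") auto
    then have "ennreal (norm z powr (- s)) \<le> 1" by (simp add: ennreal_le_1)
    then show ?thesis by (rule order_trans) simp
  next
    case 3
    define n where "n = (LEAST n. 1 / 2 ^ Suc n \<le> norm z)"
    have ex: "\<exists>n. 1 / 2 ^ Suc n \<le> norm z"
    proof -
      obtain n where "(1 / 2) ^ n < norm z" using 3 real_arch_pow_inv[of "norm z" "1/2"] by auto
      moreover have "(1 / 2 :: real) ^ Suc n \<le> (1 / 2) ^ n" by simp
      ultimately have "1 / 2 ^ Suc n \<le> norm z" by (simp add: power_one_over field_simps)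
      then show ?thesis by blast
    qed
    have lo: "1 / 2 ^ Suc n \<le> norm z" unfolding n_def by (rule LeastI_ex[OF ex])
    have hi: "norm z < 1 / 2 ^ n"
    proof (cases n)
      case (Suc m)
      then have "\<not> 1 / 2 ^ Suc m \<le> norm z" using not_less_Least[of m "\<lambda>n. 1 / 2 ^ Suc n \<le> norm z"] n_def by auto
      then show ?thesis using Suc by simp
    qed (use 3 in simp)
    have "norm z powr (- s) \<le> (1 / 2 ^ Suc n) powr (- s)"
      using assms lo by (intro powr_mono2') auto
    also have "1 / 2 ^ Suc n = 2 powr (- real (Suc n))"
      by (simp only: powr_minus powr_realpow[of 2, simplified] inverse_eq_divide)
    also have "(2 powr (- real (Suc n))) powr (- s) = 2 powr (s * real (Suc n))"
      by (simp only: powr_powr mult_minus_left mult_minus_right minus_minus mult.commute)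
    finally have "ennreal (norm z powr (- s)) \<le> ennreal (2 powr (s * real (Suc n))) * indicator (ball 0 (1 / 2 ^ n)) z"
      using hi by (simp add: ennreal_leI)
    also have "\<dots> \<le> (\<Sum>n. ennreal (2 powr (s * real (Suc n))) * indicator (ball 0 (1 / 2 ^ n)) z)"
    proof -
      have "f n \<le> suminf f" for f :: "nat \<Rightarrow> ennreal"
        using sum_le_suminf[of f "{n}"] by (simp add: summableI)
      then show ?thesis .
    qed
    finally show ?thesis by (rule order_trans) simp
  qed
qed

text \<open>A bounded density is recorded as domination by a multiple of Lebesgue measure, so that
  neither a density function nor almost-everywhere statements have to be carried along.\<close>

locale bounded_density = prob_space \<mu> for \<mu> :: "(real ^ 'd) measure" +
  fixes B :: real
  assumes sets_eq [measurable_cong, simp]: "sets \<mu> = sets borel"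
    and B_nonneg: "B \<ge> 0"
    and emeasure_le_lborel: "A \<in> sets borel \<Longrightarrow> emeasure \<mu> A \<le> ennreal B * emeasure lborel A"
begin

lemma space_eq [simp]: "space \<mu> = UNIV"
  using sets_eq_imp_space_eq[OF sets_eq] by simp

definition ball_const :: real where "ball_const = B * unit_ball_vol (real CARD('d))"

lemma ball_const_nonneg: "ball_const \<ge> 0"
  using B_nonneg by (simp add: ball_const_def)

lemma emeasure_ball_le:
  assumes "t \<ge> 0"
  shows "emeasure \<mu> (ball x t) \<le> ennreal (ball_const * t ^ CARD('d))"
proof -
  have "emeasure \<mu> (ball x t) \<le> ennreal B * emeasure lborel (ball x t)"
    by (rule emeasure_le_lborel) simp
  also have "emeasure lborel (ball x t) = ennreal (unit_ball_vol (real CARD('d)) * t ^ CARD('d))"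
    using emeasure_ball[OF assms, of x] by simp
  finally show ?thesis
    using B_nonneg assms by (simp add: ball_const_def ennreal_mult[symmetric] mult.assoc)
qed

text \<open>The shell at distance 2^(-n) contributes at most a multiple of 2^(sn) 2^(-dn), a
  geometric series that converges because s < d. The bound is uniform in \<open>x\<close> because
  the ball estimate is.\<close>

lemma nn_integral_riesz_bounded:
  assumes "s > 0" "s < real CARD('d)"
  shows "\<exists>H. \<forall>x. (\<integral>\<^sup>+y. norm (x - y) powr (- s) \<partial>\<mu>) \<le> ennreal H"
proof -
  let ?d = "real CARD('d)"
  define q where "q = 2 powr (s - ?d)"
  have q: "0 < q" "q < 1" using assms by (auto simp: q_def powr_less_one)
  define a where "a = (\<lambda>n. 2 powr s * ball_const * q ^ n)"
  have a0: "a n \<ge> 0" for n using q ball_const_nonneg by (simp add: a_def)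
  have sa: "summable a" unfolding a_def using q by (intro summable_mult summable_geometric) auto
  have "(\<integral>\<^sup>+y. norm (x - y) powr (- s) \<partial>\<mu>) \<le> ennreal (1 + suminf a)" for x :: "real ^ 'd"
  proof -
    have "(\<integral>\<^sup>+y. norm (x - y) powr (- s) \<partial>\<mu>)
       \<le> (\<integral>\<^sup>+y. 1 + (\<Sum>n. ennreal (2 powr (s * real (Suc n))) * indicator (ball x (1 / 2 ^ n)) y) \<partial>\<mu>)"
    proof (rule nn_integral_mono)
      fix y
      have "indicator (ball 0 (1 / 2 ^ n)) (x - y) = (indicator (ball x (1 / 2 ^ n)) y :: ennreal)" for n :: nat
        by (simp add: indicator_def dist_norm norm_minus_commute)
      then show "ennreal (norm (x - y) powr (- s))
         \<le> 1 + (\<Sum>n. ennreal (2 powr (s * real (Suc n))) * indicator (ball x (1 / 2 ^ n)) y)"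
        using powr_minus_le_dyadic[OF assms(1), of "x - y"] by simp
    qed
    also have "\<dots> = 1 + (\<Sum>n. ennreal (2 powr (s * real (Suc n))) * emeasure \<mu> (ball x (1 / 2 ^ n)))"
    proof -
      have ind: "(\<lambda>y. ennreal (2 powr (s * real (Suc n))) * indicator (ball x (1 / 2 ^ n)) y) \<in> borel_measurable \<mu>" for n
        by (intro borel_measurable_times_ennreal borel_measurable_indicator borel_measurable_const) simp
      have "(\<integral>\<^sup>+y. 1 + (\<Sum>n. ennreal (2 powr (s * real (Suc n))) * indicator (ball x (1 / 2 ^ n)) y) \<partial>\<mu>)
          = (\<integral>\<^sup>+y. 1 \<partial>\<mu>) + (\<integral>\<^sup>+y. (\<Sum>n. ennreal (2 powr (s * real (Suc n))) * indicator (ball x (1 / 2 ^ n)) y) \<partial>\<mu>)"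
        by (intro nn_integral_add borel_measurable_const borel_measurable_suminf_order ind)
      also have "(\<integral>\<^sup>+y. (\<Sum>n. ennreal (2 powr (s * real (Suc n))) * indicator (ball x (1 / 2 ^ n)) y) \<partial>\<mu>)
          = (\<Sum>n. \<integral>\<^sup>+y. ennreal (2 powr (s * real (Suc n))) * indicator (ball x (1 / 2 ^ n)) y \<partial>\<mu>)"
        by (rule nn_integral_suminf) (rule ind)
      also have "\<dots> = (\<Sum>n. ennreal (2 powr (s * real (Suc n))) * emeasure \<mu> (ball x (1 / 2 ^ n)))"
        by (intro suminf_cong nn_integral_cmult_indicator) simp
      also have "(\<integral>\<^sup>+y. 1 \<partial>\<mu>) = 1"
        using emeasure_space_1 by simp
      finally show ?thesis .
    qed
    also have "\<dots> \<le> 1 + (\<Sum>n. ennreal (a n))"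
    proof (intro add_left_mono suminf_le summableI)
      fix n
      have "ennreal (2 powr (s * real (Suc n))) * emeasure \<mu> (ball x (1 / 2 ^ n))
          \<le> ennreal (2 powr (s * real (Suc n))) * ennreal (ball_const * (1 / 2 ^ n) ^ CARD('d))"
        by (intro mult_left_mono emeasure_ball_le) auto
      also have "\<dots> = ennreal (2 powr (s * real (Suc n)) * (ball_const * (1 / 2 ^ n) ^ CARD('d)))"
        using ball_const_nonneg by (simp add: ennreal_mult)
      also have "2 powr (s * real (Suc n)) * (ball_const * (1 / 2 ^ n) ^ CARD('d)) = a n"
      proof -
        have "(1 / 2 ^ n) ^ CARD('d) = 2 powr (- ?d * real n)"
          by (simp add: powr_minus power_one_over power_mult[symmetric] powr_realpow[symmetric] powr_powr field_simps)
        moreover have "q ^ n = 2 powr ((s - ?d) * real n)"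
          using q by (simp add: q_def powr_powr flip: powr_realpow)
        ultimately show ?thesis
          by (simp add: a_def powr_add[symmetric] algebra_simps)
      qed
      finally show "ennreal (2 powr (s * real (Suc n))) * emeasure \<mu> (ball x (1 / 2 ^ n)) \<le> ennreal (a n)" .
    qed
    also have "\<dots> = ennreal (1 + suminf a)"
      using a0 sa suminf_nonneg[OF sa a0] by (subst suminf_ennreal2) (auto simp: ennreal_plus)
    finally show ?thesis .
  qed
  then show ?thesis by blast
qed

lemma measurable_ball_indicator [measurable]:
  "(\<lambda>z. indicator (ball (fst z) t) (snd z) :: ennreal) \<in> borel_measurable (borel \<Otimes>\<^sub>M (borel :: (real ^ 'd) measure))"
proof -
  have "(\<lambda>z. indicator {z. dist (fst z) (snd z) < t} z :: ennreal) \<in> borel_measurable (borel \<Otimes>\<^sub>M (borel :: (real ^ 'd) measure))"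
    by measurable
  then show ?thesis by (simp add: indicator_def)
qed

lemma measurable_emeasure_ball [measurable]: "(\<lambda>x. emeasure \<mu> (ball x t)) \<in> borel_measurable borel"
proof -
  have "(\<lambda>x. \<integral>\<^sup>+y. indicator (ball (fst (x, y)) t) (snd (x, y)) \<partial>\<mu>) \<in> borel_measurable borel"
    by measurable
  then show ?thesis by simp
qed

lemma emeasure_ball_half:
  "\<exists>R>0. emeasure \<mu> (ball 0 R) \<ge> ennreal (1 / 2)"
proof -
  have "(\<lambda>n. measure \<mu> (ball 0 (real n))) \<longlonglongrightarrow> measure \<mu> (\<Union>n. ball 0 (real n))"
    by (intro finite_Lim_measure_incseq) (auto simp: incseq_def)
  moreover have "(\<Union>n. ball 0 (real n)) = (UNIV :: (real ^ 'd) set)"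
    using reals_Archimedean2 by auto
  ultimately have "(\<lambda>n. measure \<mu> (ball 0 (real n))) \<longlonglongrightarrow> 1"
    using prob_space by simp
  then have "eventually (\<lambda>n. measure \<mu> (ball 0 (real n)) > 1 / 2) sequentially"
    by (rule order_tendstoD) simp
  then have "eventually (\<lambda>n. measure \<mu> (ball 0 (real n)) > 1 / 2 \<and> n > 0) sequentially"
    using eventually_gt_at_top by (rule eventually_conj)
  then obtain n where "measure \<mu> (ball 0 (real n)) > 1 / 2" "n > 0"
    by (auto simp: eventually_sequentially)
  then show ?thesis by (intro exI[of _ "real n"]) (auto simp: emeasure_eq_measure simp del: ennreal_half intro!: ennreal_leI)
qed

text \<open>With \<open>a z\<close> the mass of the ball of radius \<open>t / 2\<close> around \<open>z\<close>, the left-hand side is, up to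
  the volume of such a ball, at least the integral of \<open>a\<^sup>2\<close>; the latter is estimated from below by
  \<open>2 * l * a - l\<^sup>2\<close> on a fixed large ball.\<close>

lemma close_pairs_lower_bound:
  "\<exists>c>0. \<forall>t. 0 < t \<and> t \<le> 1 \<longrightarrow> (\<integral>\<^sup>+x. emeasure \<mu> (ball x t) \<partial>\<mu>) \<ge> ennreal (c * t ^ CARD('d))"
proof -
  obtain R where R: "R > 0" "emeasure \<mu> (ball 0 R) \<ge> ennreal (1 / 2)" using emeasure_ball_half by auto
  define d where "d = CARD('d)"
  define w where "w = unit_ball_vol (real d)"
  have w: "w > 0" by (simp add: w_def)
  define V where "V = w * (R + 1) ^ d"
  have V: "V > 0" using w R by (simp add: V_def)
  have vol: "emeasure lborel (ball x r) = ennreal (w * r ^ d)" if "r \<ge> 0" for x :: "real ^ 'd" and r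
    using emeasure_ball[OF that, of x] by (simp add: w_def d_def)
  interpret L: pair_sigma_finite \<mu> "lborel :: (real ^ 'd) measure"
    by unfold_locales
  have pair_meas: "borel_measurable (\<mu> \<Otimes>\<^sub>M (lborel :: (real ^ 'd) measure)) = (borel_measurable (borel \<Otimes>\<^sub>M borel) :: (_ \<Rightarrow> ennreal) set)"
    by (intro measurable_cong_sets sets_pair_measure_cong) auto
  show ?thesis
  proof (intro exI[of _ "w / (4 * V * 2 ^ d)"] conjI allI impI)
    show "w / (4 * V * 2 ^ d) > 0" using w V by simp
    fix t :: real assume t: "0 < t \<and> t \<le> 1"
    \<comment> \<open>Two points within t/2 of a common point are within t of each other.\<close>
    define r where "r = t / 2"
    have r: "r > 0" "r \<le> 1" using t by (auto simp: r_def)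
    define v where "v = w * r ^ d"
    have v: "v > 0" using w r by (simp add: v_def)
    define G where "G = (\<integral>\<^sup>+x. emeasure \<mu> (ball x t) \<partial>\<mu>)"
    \<comment> \<open>The radius is enlarged by 1 >= r so that \<open>?S\<close> contains the whole
      \<open>r\<close>-ball around every point of \<open>ball 0 R\<close>.\<close>
    let ?S = "ball 0 (R + 1) :: (real ^ 'd) set"
    \<comment> \<open>The maximiser of l v - l^2 V, whose maximum is l v / 2. Dividing by
      \<open>v\<close> leaves l / 2 = v / (4 V), which is the announced constant times t^d.\<close>
    define l where "l = v / (2 * V)"
    have l: "l > 0" using v V by (simp add: l_def)
    have lower: "(\<integral>\<^sup>+z. indicator ?S z * emeasure \<mu> (ball z r) \<partial>lborel) \<ge> ennreal (v / 2)"
    proof -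
      have "ennreal (v / 2) \<le> emeasure \<mu> (ball 0 R) * ennreal v"
        using mult_right_mono[OF R(2), of "ennreal v"] v by (simp add: ennreal_mult[symmetric] del: ennreal_half)
      also have "\<dots> = (\<integral>\<^sup>+x. ennreal v * indicator (ball 0 R) x \<partial>\<mu>)"
        by (subst nn_integral_cmult_indicator) (simp_all add: mult.commute)
      also have "\<dots> \<le> (\<integral>\<^sup>+x. \<integral>\<^sup>+z. indicator ?S z * indicator (ball z r) x \<partial>lborel \<partial>\<mu>)"
      proof (rule nn_integral_mono)
        fix x :: "real ^ 'd"
        show "ennreal v * indicator (ball 0 R) x \<le> (\<integral>\<^sup>+z. indicator ?S z * indicator (ball z r) x \<partial>lborel)"
        proof (cases "x \<in> ball 0 R")
          case True
          have "ennreal v = (\<integral>\<^sup>+z. indicator (ball x r) z \<partial>lborel)"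
            using vol[of r x] r by (simp add: v_def)
          also have "\<dots> \<le> (\<integral>\<^sup>+z. indicator ?S z * indicator (ball z r) x \<partial>lborel)"
          proof (rule nn_integral_mono)
            fix z
            show "indicator (ball x r) z \<le> (indicator ?S z * indicator (ball z r) x :: ennreal)"
            proof (cases "z \<in> ball x r")
              case zx: True
              have "norm z \<le> norm x + dist x z"
                using norm_triangle_sub[of z x] by (simp add: dist_norm norm_minus_commute)
              then have "z \<in> ?S" using True zx r by (auto simp: dist_norm)
              moreover have "x \<in> ball z r" using zx by (simp add: dist_commute)
              ultimately show ?thesis using zx by simp
            qed simp
          qed
          finally show ?thesis using True by simp
        qed simp
      qed
      also have "\<dots> = (\<integral>\<^sup>+z. \<integral>\<^sup>+x. indicator ?S z * indicator (ball z r) x \<partial>\<mu> \<partial>lborel)"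
      proof (rule L.Fubini'[symmetric])
        have "(\<lambda>p. indicator (ball (snd p) r) (fst p) :: ennreal) \<in> borel_measurable (borel \<Otimes>\<^sub>M (borel :: (real ^ 'd) measure))"
          using measurable_compose[OF measurable_pair_swap', OF measurable_ball_indicator] by (simp add: case_prod_beta')
        moreover have "(\<lambda>p. indicator ?S (snd p) :: ennreal) \<in> borel_measurable (borel \<Otimes>\<^sub>M (borel :: (real ^ 'd) measure))"
          by (intro measurable_compose[OF measurable_snd] borel_measurable_indicator) simp
        ultimately show "(\<lambda>(x, z). indicator ?S z * indicator (ball z r) x :: ennreal) \<in> borel_measurable (\<mu> \<Otimes>\<^sub>M lborel)"
          unfolding pair_meas case_prod_beta' by (intro borel_measurable_times_ennreal)
      qed
      also have "\<dots> = (\<integral>\<^sup>+z. indicator ?S z * emeasure \<mu> (ball z r) \<partial>lborel)"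
        by (simp add: nn_integral_cmult_indicator)
      finally show ?thesis .
    qed
    have upper: "(\<integral>\<^sup>+z. emeasure \<mu> (ball z r) * emeasure \<mu> (ball z r) \<partial>lborel) \<le> ennreal v * G"
    proof -
      have "(\<integral>\<^sup>+z. emeasure \<mu> (ball z r) * emeasure \<mu> (ball z r) \<partial>lborel)
         = (\<integral>\<^sup>+z. \<integral>\<^sup>+x. emeasure \<mu> (ball z r) * indicator (ball z r) x \<partial>\<mu> \<partial>lborel)"
        by (simp add: nn_integral_cmult_indicator)
      also have "\<dots> \<le> (\<integral>\<^sup>+z. \<integral>\<^sup>+x. emeasure \<mu> (ball x t) * indicator (ball x r) z \<partial>\<mu> \<partial>lborel)"
      proof (rule nn_integral_mono, rule nn_integral_mono)
        fix z x :: "real ^ 'd"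
        show "emeasure \<mu> (ball z r) * indicator (ball z r) x \<le> emeasure \<mu> (ball x t) * indicator (ball x r) z"
        proof (cases "dist z x < r")
          case True
          have "ball z r \<subseteq> ball x t"
          proof
            fix y assume "y \<in> ball z r"
            then show "y \<in> ball x t"
              using True dist_triangle[of x y z] by (simp add: r_def dist_commute)
          qed
          then have "emeasure \<mu> (ball z r) \<le> emeasure \<mu> (ball x t)" by (intro emeasure_mono) auto
          then show ?thesis using True by (simp add: dist_commute)
        qed simp
      qed
      also have "\<dots> = (\<integral>\<^sup>+x. \<integral>\<^sup>+z. emeasure \<mu> (ball x t) * indicator (ball x r) z \<partial>lborel \<partial>\<mu>)"
      proof (rule L.Fubini')
        show "(\<lambda>(x, z). emeasure \<mu> (ball x t) * indicator (ball x r) z) \<in> borel_measurable (\<mu> \<Otimes>\<^sub>M lborel)"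
          unfolding pair_meas by (simp add: case_prod_beta')
      qed
      also have "\<dots> = (\<integral>\<^sup>+x. ennreal v * emeasure \<mu> (ball x t) \<partial>\<mu>)"
      proof (rule nn_integral_cong)
        fix x
        have "(\<integral>\<^sup>+z. emeasure \<mu> (ball x t) * indicator (ball x r) z \<partial>lborel) = emeasure \<mu> (ball x t) * emeasure lborel (ball x r)"
          by (rule nn_integral_cmult_indicator) simp
        then show "(\<integral>\<^sup>+z. emeasure \<mu> (ball x t) * indicator (ball x r) z \<partial>lborel) = ennreal v * emeasure \<mu> (ball x t)"
          using vol[of r x] r by (simp add: v_def mult.commute)
      qed
      also have "\<dots> = ennreal v * G"
        unfolding G_def by (rule nn_integral_cmult) simp
      finally show ?thesis .
    qed
    have "ennreal (l * v) = ennreal (2 * l) * ennreal (v / 2)"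
      using l v by (simp add: ennreal_mult[symmetric])
    also have "\<dots> \<le> ennreal (2 * l) * (\<integral>\<^sup>+z. indicator ?S z * emeasure \<mu> (ball z r) \<partial>lborel)"
      by (intro mult_left_mono lower) auto
    also have "\<dots> = (\<integral>\<^sup>+z. ennreal (2 * l) * (indicator ?S z * emeasure \<mu> (ball z r)) \<partial>lborel)"
    proof (rule nn_integral_cmult[symmetric])
      have "(\<lambda>z. indicator ?S z * emeasure \<mu> (ball z r)) \<in> borel_measurable borel"
        by (intro borel_measurable_times_ennreal borel_measurable_indicator measurable_emeasure_ball) simp
      then show "(\<lambda>z. indicator ?S z * emeasure \<mu> (ball z r)) \<in> borel_measurable lborel" by simp
    qed
    also have "\<dots> \<le> (\<integral>\<^sup>+z. emeasure \<mu> (ball z r) * emeasure \<mu> (ball z r) + ennreal (l\<^sup>2) * indicator ?S z \<partial>lborel)"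
    proof (rule nn_integral_mono)
      fix z
      let ?a = "measure \<mu> (ball z r)"
      have "0 \<le> (?a - l)\<^sup>2" by simp
      then have "2 * l * ?a \<le> ?a * ?a + l\<^sup>2" by (simp add: power2_eq_square algebra_simps)
      then have "ennreal (2 * l * ?a) \<le> ennreal (?a * ?a + l\<^sup>2)" by (rule ennreal_leI)
      then show "ennreal (2 * l) * (indicator ?S z * emeasure \<mu> (ball z r))
          \<le> emeasure \<mu> (ball z r) * emeasure \<mu> (ball z r) + ennreal (l\<^sup>2) * indicator ?S z"
        using l by (auto simp: emeasure_eq_measure ennreal_mult ennreal_plus indicator_def)
    qed
    also have "\<dots> = (\<integral>\<^sup>+z. emeasure \<mu> (ball z r) * emeasure \<mu> (ball z r) \<partial>lborel) + ennreal (l\<^sup>2) * ennreal V"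
    proof -
      have "(\<lambda>z. emeasure \<mu> (ball z r) * emeasure \<mu> (ball z r)) \<in> borel_measurable borel"
        by (intro borel_measurable_times_ennreal measurable_emeasure_ball)
      then have "(\<lambda>z. emeasure \<mu> (ball z r) * emeasure \<mu> (ball z r)) \<in> borel_measurable lborel"
        by simp
      moreover have "(\<lambda>z. ennreal (l\<^sup>2) * indicator ?S z) \<in> borel_measurable lborel"
        by (intro borel_measurable_times_ennreal borel_measurable_indicator borel_measurable_const) simp
      moreover have "(\<integral>\<^sup>+z. ennreal (l\<^sup>2) * indicator ?S z \<partial>lborel) = ennreal (l\<^sup>2) * ennreal V"
        using vol[of "R + 1" 0] R by (subst nn_integral_cmult_indicator) (auto simp: V_def)
      ultimately show ?thesis by (simp only: nn_integral_add)
    qed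
    also have "\<dots> \<le> ennreal v * G + ennreal (l * v / 2)"
    proof (intro add_mono upper)
      have "l * v / 2 = l\<^sup>2 * V" using V by (simp add: l_def power2_eq_square field_simps)
      then have "ennreal (l * v / 2) = ennreal (l\<^sup>2) * ennreal V"
        using V by (simp only:) (intro ennreal_mult; simp)
      then show "ennreal (l\<^sup>2) * ennreal V \<le> ennreal (l * v / 2)"
        by simp
    qed
    finally have "ennreal (l * v / 2) + ennreal (l * v / 2) \<le> ennreal v * G + ennreal (l * v / 2)"
      using l v by (simp add: ennreal_plus[symmetric] del: ennreal_plus)
    then have "ennreal (l * v / 2) \<le> ennreal v * G"
      by (simp add: ennreal_add_left_cancel_le add.commute)
    then have "ennreal (1 / v) * ennreal (l * v / 2) \<le> ennreal (1 / v) * (ennreal v * G)"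
      by (intro mult_left_mono) auto
    also have "\<dots> = G"
      using v by (simp add: mult.assoc[symmetric] ennreal_mult[symmetric])
    also have "ennreal (1 / v) * ennreal (l * v / 2) = ennreal (l / 2)"
      using v l by (simp add: ennreal_mult[symmetric])
    also have "l / 2 = w / (4 * V * 2 ^ d) * t ^ CARD('d)"
      by (simp add: l_def v_def r_def d_def power_divide field_simps)
    finally show "ennreal (w / (4 * V * 2 ^ d) * t ^ CARD('d)) \<le> (\<integral>\<^sup>+x. emeasure \<mu> (ball x t) \<partial>\<mu>)"
      by (simp add: G_def)
  qed
qed

end

text \<open>Inside the inner radius the value drops to 0 instead of being capped, so that a
  truncation is exactly a sum of \<open>n\<close> geometric shells. The outer radius confines it to
  distances at which the Riesz kernel will dominate the potentials.\<close>

definition truncated_kernel :: "real \<Rightarrow> real \<Rightarrow> real \<Rightarrow> nat \<Rightarrow> real ^ 'd \<Rightarrow> real" where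
  "truncated_kernel a r \<rho> n z = (if r * \<rho> ^ n \<le> norm z \<and> norm z < r then norm z powr (- a) else 0)"

definition shell_kernel :: "real \<Rightarrow> real \<Rightarrow> real \<Rightarrow> nat \<Rightarrow> real ^ 'd \<Rightarrow> real" where
  "shell_kernel a r \<rho> n z = (if r * \<rho> ^ Suc n \<le> norm z \<and> norm z < r * \<rho> ^ n then norm z powr (- a) else 0)"

lemma truncated_kernel_nonneg: "truncated_kernel a r \<rho> n z \<ge> 0"
  by (simp add: truncated_kernel_def)

lemma truncated_kernel_0 [simp]: "truncated_kernel a r \<rho> 0 z = 0"
  by (auto simp: truncated_kernel_def)

lemma truncated_kernel_Suc:
  assumes "0 < \<rho>" "\<rho> < 1" "r > 0"
  shows "truncated_kernel a r \<rho> (Suc n) z = truncated_kernel a r \<rho> n z + shell_kernel a r \<rho> n z"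
proof -
  have "\<rho> ^ Suc n \<le> \<rho> ^ n" "\<rho> ^ n \<le> 1" using assms by (auto simp: power_le_one mult_left_le_one_le)
  then have "r * \<rho> ^ Suc n \<le> r * \<rho> ^ n" "r * \<rho> ^ n \<le> r" using assms by (auto simp: mult_left_le)
  then show ?thesis by (auto simp: truncated_kernel_def shell_kernel_def)
qed

lemma measurable_truncated_kernel [measurable]: "truncated_kernel a r \<rho> n \<in> borel_measurable borel"
  unfolding truncated_kernel_def[abs_def] by measurable

lemma measurable_shell_kernel [measurable]: "shell_kernel a r \<rho> n \<in> borel_measurable borel"
  unfolding shell_kernel_def[abs_def] by measurable

section \<open>Integrals of truncated inverse powers\<close>

context bounded_density
begin

lemma nn_integral_truncated_Suc:
  assumes "0 < \<rho>" "\<rho> < 1" "r > 0"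
  shows "(\<integral>\<^sup>+y. truncated_kernel a r \<rho> (Suc n) (x - y) \<partial>\<mu>)
    = (\<integral>\<^sup>+y. truncated_kernel a r \<rho> n (x - y) \<partial>\<mu>) + (\<integral>\<^sup>+y. shell_kernel a r \<rho> n (x - y) \<partial>\<mu>)"
proof -
  have "(\<lambda>y. ennreal (truncated_kernel a r \<rho> n (x - y))) \<in> borel_measurable \<mu>"
    "(\<lambda>y. ennreal (shell_kernel a r \<rho> n (x - y))) \<in> borel_measurable \<mu>"
    by measurable
  from nn_integral_add[OF this] show ?thesis
    unfolding truncated_kernel_Suc[OF assms]
    by (simp add: truncated_kernel_nonneg shell_kernel_def)
qed

text \<open>Height times volume of a shell: the shells form a geometric progression of ratio
  \<rho>^(d-a). For a = 2s this ratio is 1 at s = d/2, where all shells weigh the same, and larger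
  than 1 for s > d/2.\<close>

lemma powr_scale:
  assumes "0 < \<rho>" "0 < r"
  shows "(r * \<rho> ^ n) powr (- a) * (r * \<rho> ^ n) ^ CARD('d)
    = r powr (real CARD('d) - a) * (\<rho> powr (real CARD('d) - a)) ^ n"
proof -
  define t where "t = r * \<rho> ^ n"
  have t: "t > 0" using assms by (simp add: t_def)
  have "t powr (- a) * t ^ CARD('d) = t powr (real CARD('d) - a)"
    using t by (simp add: powr_realpow[symmetric] powr_add[symmetric])
  also have "\<dots> = r powr (real CARD('d) - a) * (\<rho> powr (real CARD('d) - a)) ^ n"
    using assms by (simp add: t_def powr_mult powr_power powr_powr mult.commute flip: powr_realpow)
  finally show ?thesis by (simp add: t_def)
qed

text \<open>The power is at most its value at the inner radius and the mass at most that of the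
  outer ball, at the price of \<open>\<rho> powr (- a)\<close>. The constant \<open>C\<close> is
  left free above \<open>ball_const\<close> because a larger one is chosen later.\<close>

lemma nn_integral_shell_le:
  assumes "0 < \<rho>" "\<rho> < 1" "r > 0" "a > 0" "C \<ge> ball_const"
  shows "(\<integral>\<^sup>+y. shell_kernel a r \<rho> n (x - y) \<partial>\<mu>)
    \<le> ennreal (C * r powr (real CARD('d) - a) * \<rho> powr (- a) * (\<rho> powr (real CARD('d) - a)) ^ n)"
proof -
  define t where "t = r * \<rho> ^ n"
  have t: "t > 0" using assms by (simp add: t_def)
  have C: "C \<ge> 0" using assms(5) ball_const_nonneg by linarith
  have "(\<integral>\<^sup>+y. shell_kernel a r \<rho> n (x - y) \<partial>\<mu>) \<le> (\<integral>\<^sup>+y. ennreal ((\<rho> * t) powr (- a)) * indicator (ball x t) y \<partial>\<mu>)"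
  proof (rule nn_integral_mono)
    fix y
    show "ennreal (shell_kernel a r \<rho> n (x - y)) \<le> ennreal ((\<rho> * t) powr (- a)) * indicator (ball x t) y"
    proof (cases "r * \<rho> ^ Suc n \<le> norm (x - y) \<and> norm (x - y) < r * \<rho> ^ n")
      case True
      then have "norm (x - y) powr (- a) \<le> (\<rho> * t) powr (- a)"
        using assms t by (intro powr_mono2') (auto simp: t_def mult_ac)
      then show ?thesis using True by (simp add: shell_kernel_def t_def dist_norm ennreal_leI)
    qed (auto simp: shell_kernel_def)
  qed
  also have "\<dots> = ennreal ((\<rho> * t) powr (- a)) * emeasure \<mu> (ball x t)"
    by (rule nn_integral_cmult_indicator) simp
  also have "\<dots> \<le> ennreal ((\<rho> * t) powr (- a)) * ennreal (C * t ^ CARD('d))"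
  proof (rule mult_left_mono)
    have "emeasure \<mu> (ball x t) \<le> ennreal (ball_const * t ^ CARD('d))"
      using t by (intro emeasure_ball_le) simp
    also have "\<dots> \<le> ennreal (C * t ^ CARD('d))"
      using assms(5) t by (intro ennreal_leI mult_right_mono) auto
    finally show "emeasure \<mu> (ball x t) \<le> ennreal (C * t ^ CARD('d))" .
  qed simp
  also have "\<dots> = ennreal (C * \<rho> powr (- a) * (t powr (- a) * t ^ CARD('d)))"
    using C t assms by (simp add: ennreal_mult[symmetric] powr_mult mult_ac)
  also have "\<dots> = ennreal (C * r powr (real CARD('d) - a) * \<rho> powr (- a) * (\<rho> powr (real CARD('d) - a)) ^ n)"
    unfolding t_def powr_scale[OF assms(1,3)] by (simp add: mult_ac)
  finally show ?thesis .
qed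

lemma nn_integral_truncated_le:
  assumes "0 < \<rho>" "\<rho> < 1" "r > 0" "a > 0" "C \<ge> ball_const"
  shows "(\<integral>\<^sup>+y. truncated_kernel a r \<rho> n (x - y) \<partial>\<mu>)
    \<le> ennreal (C * r powr (real CARD('d) - a) * \<rho> powr (- a) * (\<Sum>k<n. (\<rho> powr (real CARD('d) - a)) ^ k))"
proof (induction n)
  case (Suc n)
  have C: "C \<ge> 0" using assms(5) ball_const_nonneg by linarith
  let ?K = "C * r powr (real CARD('d) - a) * \<rho> powr (- a)" and ?q = "\<rho> powr (real CARD('d) - a)"
  have K: "?K \<ge> 0" using C by simp
  have "(\<integral>\<^sup>+y. truncated_kernel a r \<rho> (Suc n) (x - y) \<partial>\<mu>) \<le> ennreal (?K * (\<Sum>k<n. ?q ^ k)) + ennreal (?K * ?q ^ n)"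
    unfolding nn_integral_truncated_Suc[OF assms(1-3)]
    by (intro add_mono Suc.IH nn_integral_shell_le assms)
  also have "\<dots> = ennreal (?K * (\<Sum>k<n. ?q ^ k) + ?K * ?q ^ n)"
    using K C by (intro ennreal_plus[symmetric] mult_nonneg_nonneg sum_nonneg) auto
  also have "?K * (\<Sum>k<n. ?q ^ k) + ?K * ?q ^ n = ?K * (\<Sum>k<Suc n. ?q ^ k)"
    by (simp add: distrib_left)
  finally show ?case .
qed simp

text \<open>The inner ball has mass at most C \<rho>^d t^d at every point, and \<open>small\<close>
  makes this at most half of the mean mass of the outer ball. The annulus thus keeps half of that
  mean, which is why the ratio \<rho> must depend on the measure.\<close>

lemma nn_integral_shell_ge:
  assumes "0 < \<rho>" "\<rho> < 1" "0 < r" "r \<le> 1" "a > 0" "C \<ge> ball_const" "c > 0"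
    and c: "\<And>t. 0 < t \<Longrightarrow> t \<le> 1 \<Longrightarrow> ennreal (c * t ^ CARD('d)) \<le> (\<integral>\<^sup>+x. emeasure \<mu> (ball x t) \<partial>\<mu>)"
    and small: "C * \<rho> ^ CARD('d) \<le> c / 2"
  shows "ennreal (c / 2 * r powr (real CARD('d) - a) * (\<rho> powr (real CARD('d) - a)) ^ n)
    \<le> (\<integral>\<^sup>+x. \<integral>\<^sup>+y. shell_kernel a r \<rho> n (x - y) \<partial>\<mu> \<partial>\<mu>)"
proof -
  define t where "t = r * \<rho> ^ n"
  have "\<rho> ^ n \<le> 1" using assms by (simp add: power_le_one)
  then have t: "0 < t" "t \<le> 1" using assms by (auto simp: t_def mult_le_one)
  define X where "X = (\<integral>\<^sup>+x. emeasure \<mu> (ball x t - ball x (\<rho> * t)) \<partial>\<mu>)"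
  let ?h = "c / 2 * t ^ CARD('d)"
  have h: "?h \<ge> 0" using t assms by simp
  have sub: "ball x (\<rho> * t) \<subseteq> ball x t" for x :: "real ^ 'd"
    using t assms by (intro subset_ball) (simp add: mult_left_le_one_le)
  have meas: "(\<lambda>x. emeasure \<mu> (ball x t - ball x (\<rho> * t))) \<in> borel_measurable \<mu>"
  proof -
    have "emeasure \<mu> (ball x t - ball x (\<rho> * t)) = emeasure \<mu> (ball x t) - emeasure \<mu> (ball x (\<rho> * t))" for x
      using sub by (intro emeasure_Diff) auto
    then show ?thesis by simp
  qed
  have "ennreal ?h + ennreal ?h = ennreal (c * t ^ CARD('d))"
    using h by (simp add: ennreal_plus[symmetric] del: ennreal_plus)
  also have "\<dots> \<le> (\<integral>\<^sup>+x. emeasure \<mu> (ball x t) \<partial>\<mu>)"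
    by (rule c[OF t])
  also have "\<dots> \<le> (\<integral>\<^sup>+x. emeasure \<mu> (ball x t - ball x (\<rho> * t)) + ennreal ?h \<partial>\<mu>)"
  proof (rule nn_integral_mono)
    fix x
    have "emeasure \<mu> (ball x t) = emeasure \<mu> (ball x t - ball x (\<rho> * t)) + emeasure \<mu> (ball x (\<rho> * t))"
      using sub[of x] by (subst plus_emeasure) (auto intro: arg_cong[where f = "emeasure \<mu>"])
    also have "emeasure \<mu> (ball x (\<rho> * t)) \<le> ennreal (ball_const * (\<rho> * t) ^ CARD('d))"
      using t assms by (intro emeasure_ball_le) simp
    also have "\<dots> \<le> ennreal (C * (\<rho> * t) ^ CARD('d))"
      using t assms by (intro ennreal_leI mult_right_mono) auto
    also have "C * (\<rho> * t) ^ CARD('d) = C * \<rho> ^ CARD('d) * t ^ CARD('d)"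
      by (simp add: power_mult_distrib)
    also have "ennreal \<dots> \<le> ennreal ?h"
      using small t by (intro ennreal_leI mult_right_mono) auto
    finally show "emeasure \<mu> (ball x t) \<le> emeasure \<mu> (ball x t - ball x (\<rho> * t)) + ennreal ?h"
      by (simp add: add_left_mono)
  qed
  also have "\<dots> = X + ennreal ?h"
    unfolding X_def using meas emeasure_space_1 by (subst nn_integral_add) auto
  finally have X: "ennreal ?h \<le> X"
    by (simp add: ennreal_add_left_cancel_le add.commute)
  have "ennreal (c / 2 * r powr (real CARD('d) - a) * (\<rho> powr (real CARD('d) - a)) ^ n)
      = ennreal (t powr (- a)) * ennreal ?h"
    using h powr_scale[OF assms(1,3), of n a]
    by (simp add: ennreal_mult[symmetric] t_def[symmetric] mult_ac)
  also have "\<dots> \<le> ennreal (t powr (- a)) * X"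
    by (intro mult_left_mono X) simp
  also have "\<dots> = (\<integral>\<^sup>+x. ennreal (t powr (- a)) * emeasure \<mu> (ball x t - ball x (\<rho> * t)) \<partial>\<mu>)"
    unfolding X_def using meas by (simp add: nn_integral_cmult)
  also have "\<dots> = (\<integral>\<^sup>+x. \<integral>\<^sup>+y. ennreal (t powr (- a)) * indicator (ball x t - ball x (\<rho> * t)) y \<partial>\<mu> \<partial>\<mu>)"
    by (intro nn_integral_cong nn_integral_cmult_indicator[symmetric]) simp
  also have "\<dots> \<le> (\<integral>\<^sup>+x. \<integral>\<^sup>+y. shell_kernel a r \<rho> n (x - y) \<partial>\<mu> \<partial>\<mu>)"
  proof (rule nn_integral_mono, rule nn_integral_mono)
    fix x y :: "real ^ 'd"
    show "ennreal (t powr (- a)) * indicator (ball x t - ball x (\<rho> * t)) y \<le> ennreal (shell_kernel a r \<rho> n (x - y))"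
    proof (cases "y \<in> ball x t - ball x (\<rho> * t)")
      case True
      then have *: "r * \<rho> ^ Suc n \<le> norm (x - y)" "norm (x - y) < r * \<rho> ^ n"
        by (auto simp: t_def dist_norm mult_ac)
      moreover have "0 < norm (x - y)" using *(1) assms by (smt (verit) mult_pos_pos zero_less_power)
      ultimately have "t powr (- a) \<le> norm (x - y) powr (- a)"
        using assms by (intro powr_mono2') (auto simp: t_def)
      then show ?thesis using * True by (simp add: shell_kernel_def ennreal_leI)
    qed simp
  qed
  finally show ?thesis .
qed

text \<open>The geometric sum is the one of \<open>nn_integral_truncated_le\<close>, so the lower
  bound in the mean and the uniform upper bound differ by a factor independent of
  \<open>n\<close>.\<close>

lemma nn_integral_truncated_ge:
  assumes "0 < \<rho>" "\<rho> < 1" "0 < r" "r \<le> 1" "a > 0" "C \<ge> ball_const" "c > 0"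
    and c: "\<And>t. 0 < t \<Longrightarrow> t \<le> 1 \<Longrightarrow> ennreal (c * t ^ CARD('d)) \<le> (\<integral>\<^sup>+x. emeasure \<mu> (ball x t) \<partial>\<mu>)"
    and small: "C * \<rho> ^ CARD('d) \<le> c / 2"
  shows "ennreal (c / 2 * r powr (real CARD('d) - a) * (\<Sum>k<n. (\<rho> powr (real CARD('d) - a)) ^ k))
    \<le> (\<integral>\<^sup>+x. \<integral>\<^sup>+y. truncated_kernel a r \<rho> n (x - y) \<partial>\<mu> \<partial>\<mu>)"
proof (induction n)
  case (Suc n)
  let ?K = "c / 2 * r powr (real CARD('d) - a)" and ?q = "\<rho> powr (real CARD('d) - a)"
  have K: "?K \<ge> 0" using assms by simp
  have meas: "(\<lambda>x. \<integral>\<^sup>+y. ennreal (f (x - y)) \<partial>\<mu>) \<in> borel_measurable \<mu>"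
    if [measurable]: "f \<in> borel_measurable borel" for f :: "real ^ 'd \<Rightarrow> real"
  proof -
    have "(\<lambda>x. \<integral>\<^sup>+y. ennreal (f (x - y)) \<partial>\<mu>) \<in> borel_measurable borel" by measurable
    then show ?thesis by simp
  qed
  have "?K * (\<Sum>k<Suc n. ?q ^ k) = ?K * (\<Sum>k<n. ?q ^ k) + ?K * ?q ^ n"
    by (simp add: distrib_left)
  then have "ennreal (?K * (\<Sum>k<Suc n. ?q ^ k)) = ennreal (?K * (\<Sum>k<n. ?q ^ k)) + ennreal (?K * ?q ^ n)"
    using K assms(7) by (simp only:) (intro ennreal_plus mult_nonneg_nonneg sum_nonneg, auto)
  also have "\<dots> \<le> (\<integral>\<^sup>+x. \<integral>\<^sup>+y. truncated_kernel a r \<rho> n (x - y) \<partial>\<mu> \<partial>\<mu>)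
      + (\<integral>\<^sup>+x. \<integral>\<^sup>+y. shell_kernel a r \<rho> n (x - y) \<partial>\<mu> \<partial>\<mu>)"
    by (intro add_mono Suc.IH nn_integral_shell_ge[where C = C] assms)
  also have "\<dots> = (\<integral>\<^sup>+x. \<integral>\<^sup>+y. truncated_kernel a r \<rho> (Suc n) (x - y) \<partial>\<mu> \<partial>\<mu>)"
    unfolding nn_integral_truncated_Suc[OF assms(1-3)]
    by (intro nn_integral_add[symmetric] meas) measurable
  finally show ?case .
qed simp

end

section \<open>The partition function\<close>

lemma measurable_riesz_kernel [measurable]: "riesz_kernel s \<in> borel_measurable borel"
  unfolding riesz_kernel_def[abs_def] by measurable

lemma riesz_kernel_nonneg: "s > 0 \<Longrightarrow> riesz_kernel s z \<ge> 0"
  by (simp add: riesz_kernel_def)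

context bounded_density
begin

lemma measurable_riesz_potential [measurable]: "riesz_potential s \<mu> \<in> borel_measurable borel"
proof -
  have "(\<lambda>x. \<integral>y. riesz_kernel s (x - y) \<partial>\<mu>) \<in> borel_measurable borel"
    by measurable
  then show ?thesis unfolding riesz_potential_def[abs_def] .
qed

lemma riesz_bounds:
  assumes s: "s > 0" "s < real CARD('d)"
  obtains H where "H > 0" "\<And>x. integrable \<mu> (\<lambda>y. riesz_kernel s (x - y))"
    "\<And>x. (\<integral>\<^sup>+y. riesz_kernel s (x - y) \<partial>\<mu>) \<le> ennreal H"
    "\<And>x. 0 \<le> riesz_potential s \<mu> x" "\<And>x. riesz_potential s \<mu> x \<le> H"
    "integrable \<mu> (riesz_potential s \<mu>)"
    "2 * riesz_energy s \<mu> = (\<integral>x. riesz_potential s \<mu> x \<partial>\<mu>)"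
    "0 \<le> riesz_energy s \<mu>" "2 * riesz_energy s \<mu> \<le> H"
proof -
  obtain H0 where H0: "\<And>x. (\<integral>\<^sup>+y. norm (x - y) powr (- s) \<partial>\<mu>) \<le> ennreal H0"
    using nn_integral_riesz_bounded[OF s] by auto
  obtain m where m: "m \<ge> 0" "H0 \<le> m" using that[of "max 0 H0"] by simp
  define H where "H = m / s + 1"
  have H: "H > 0" using s m by (simp add: H_def add_nonneg_pos)
  have nn: "(\<integral>\<^sup>+y. riesz_kernel s (x - y) \<partial>\<mu>) \<le> ennreal H" for x
  proof -
    have "(\<integral>\<^sup>+y. riesz_kernel s (x - y) \<partial>\<mu>) = (\<integral>\<^sup>+y. ennreal (1 / s) * ennreal (norm (x - y) powr (- s)) \<partial>\<mu>)"
      using s by (intro nn_integral_cong) (simp add: riesz_kernel_def ennreal_mult[symmetric])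
    also have "\<dots> = ennreal (1 / s) * (\<integral>\<^sup>+y. norm (x - y) powr (- s) \<partial>\<mu>)"
      by (rule nn_integral_cmult) measurable
    also have "\<dots> \<le> ennreal (1 / s) * ennreal m"
      using m by (intro mult_left_mono order_trans[OF H0] ennreal_leI) auto
    also have "\<dots> \<le> ennreal H"
      using s m by (simp add: ennreal_mult[symmetric] H_def ennreal_leI del: ennreal_plus)
    finally show ?thesis .
  qed
  have int: "integrable \<mu> (\<lambda>y. riesz_kernel s (x - y))" for x
  proof (rule integrableI_bounded)
    show "(\<lambda>y. riesz_kernel s (x - y)) \<in> borel_measurable \<mu>" by measurable
    show "(\<integral>\<^sup>+y. ennreal (norm (riesz_kernel s (x - y))) \<partial>\<mu>) < \<infinity>"
    proof -
      have "(\<integral>\<^sup>+y. ennreal (norm (riesz_kernel s (x - y))) \<partial>\<mu>) = (\<integral>\<^sup>+y. riesz_kernel s (x - y) \<partial>\<mu>)"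
        by (intro nn_integral_cong) (simp add: riesz_kernel_nonneg[OF s(1)])
      then show ?thesis using nn[of x] by (simp add: order_le_less_trans[OF _ ennreal_less_top])
    qed
  qed
  have pos: "0 \<le> riesz_potential s \<mu> x" for x
    unfolding riesz_potential_def by (intro integral_nonneg_AE AE_I2 riesz_kernel_nonneg s)
  have le: "riesz_potential s \<mu> x \<le> H" for x
  proof -
    have "ennreal (riesz_potential s \<mu> x) = (\<integral>\<^sup>+y. riesz_kernel s (x - y) \<partial>\<mu>)"
      unfolding riesz_potential_def
      by (rule nn_integral_eq_integral[symmetric]) (auto intro: int riesz_kernel_nonneg s)
    also have "\<dots> \<le> ennreal H" by (rule nn)
    finally show ?thesis using H by simp
  qed
  have hint: "integrable \<mu> (riesz_potential s \<mu>)"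
    using pos le by (intro integrable_const_bound[of _ H]) auto
  have I: "2 * riesz_energy s \<mu> = (\<integral>x. riesz_potential s \<mu> x \<partial>\<mu>)"
    by (simp add: riesz_energy_def riesz_potential_def)
  have I0: "0 \<le> riesz_energy s \<mu>"
  proof -
    have "0 \<le> (\<integral>x. riesz_potential s \<mu> x \<partial>\<mu>)"
      by (intro Bochner_Integration.integral_nonneg pos)
    then show ?thesis using I by linarith
  qed
  have "(\<integral>x. riesz_potential s \<mu> x \<partial>\<mu>) \<le> (\<integral>x. H \<partial>\<mu>)"
    using hint le by (intro integral_mono) auto
  then have "2 * riesz_energy s \<mu> \<le> H" using I prob_space by simp
  then show thesis using that[OF H int nn pos le hint I I0] by blast
qed

text \<open>The two potentials and twice the energy are each at most \<open>H\<close>, so centering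
  changes the Riesz kernel by at most 3 H. The mean vanishes because twice the energy is the mean of
  the potential.\<close>

lemma centered_kernel_degenerate:
  assumes s: "s > 0" "s < real CARD('d)"
  shows "\<exists>B. degenerate_kernel \<mu> (centered_kernel s \<mu>) B"
proof -
  obtain H where H: "H > 0" "\<And>x. integrable \<mu> (\<lambda>y. riesz_kernel s (x - y))"
    "\<And>x. (\<integral>\<^sup>+y. riesz_kernel s (x - y) \<partial>\<mu>) \<le> ennreal H"
    "\<And>x. 0 \<le> riesz_potential s \<mu> x" "\<And>x. riesz_potential s \<mu> x \<le> H"
    "integrable \<mu> (riesz_potential s \<mu>)"
    "2 * riesz_energy s \<mu> = (\<integral>x. riesz_potential s \<mu> x \<partial>\<mu>)"
    "0 \<le> riesz_energy s \<mu>" "2 * riesz_energy s \<mu> \<le> H"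
    using riesz_bounds[OF s] by metis
  have "degenerate_kernel \<mu> (centered_kernel s \<mu>) (4 * H)"
  proof
    have "(\<lambda>z. centered_kernel s \<mu> (fst z) (snd z)) \<in> borel_measurable (borel \<Otimes>\<^sub>M borel)"
      unfolding centered_kernel_def by measurable
    moreover have "borel_measurable (\<mu> \<Otimes>\<^sub>M \<mu>) = (borel_measurable (borel \<Otimes>\<^sub>M borel) :: (_ \<Rightarrow> real) set)"
      by (intro measurable_cong_sets sets_pair_measure_cong) auto
    ultimately show "case_prod (centered_kernel s \<mu>) \<in> borel_measurable (\<mu> \<Otimes>\<^sub>M \<mu>)"
      by (simp add: case_prod_beta')
  next
    fix x y :: "real ^ 'd"
    show "centered_kernel s \<mu> x y = centered_kernel s \<mu> y x"
      by (simp add: centered_kernel_def riesz_kernel_def norm_minus_commute)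
  next
    fix x :: "real ^ 'd"
    have "(\<integral>\<^sup>+y. \<bar>centered_kernel s \<mu> x y\<bar> \<partial>\<mu>) \<le> (\<integral>\<^sup>+y. ennreal (riesz_kernel s (x - y)) + ennreal (3 * H) \<partial>\<mu>)"
    proof (rule nn_integral_mono)
      fix y
      have "\<bar>centered_kernel s \<mu> x y\<bar> \<le> riesz_kernel s (x - y) + 3 * H"
        using H(4)[of x] H(4)[of y] H(5)[of x] H(5)[of y] H(8,9) riesz_kernel_nonneg[OF s(1), of "x - y"]
        unfolding centered_kernel_def by linarith
      then have "ennreal \<bar>centered_kernel s \<mu> x y\<bar> \<le> ennreal (riesz_kernel s (x - y) + 3 * H)"
        by (rule ennreal_leI)
      then show "ennreal \<bar>centered_kernel s \<mu> x y\<bar> \<le> ennreal (riesz_kernel s (x - y)) + ennreal (3 * H)"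
        using H(1) riesz_kernel_nonneg[OF s(1), of "x - y"] by (simp add: ennreal_plus)
    qed
    also have "\<dots> = (\<integral>\<^sup>+y. riesz_kernel s (x - y) \<partial>\<mu>) + ennreal (3 * H)"
      using emeasure_space_1 by (subst nn_integral_add) auto
    also have "\<dots> \<le> ennreal H + ennreal (3 * H)"
      by (intro add_mono H) simp
    also have "\<dots> = ennreal (4 * H)"
      using H(1) by (simp add: ennreal_plus[symmetric] del: ennreal_plus)
    finally show "(\<integral>\<^sup>+y. \<bar>centered_kernel s \<mu> x y\<bar> \<partial>\<mu>) \<le> ennreal (4 * H)" .
    have "(\<integral>y. centered_kernel s \<mu> x y \<partial>\<mu>)
        = (\<integral>y. riesz_kernel s (x - y) \<partial>\<mu>) - riesz_potential s \<mu> x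
          - (\<integral>y. riesz_potential s \<mu> y \<partial>\<mu>) + 2 * riesz_energy s \<mu>"
      unfolding centered_kernel_def using H(2)[of x] H(6) prob_space by simp
    then show "(\<integral>y. centered_kernel s \<mu> x y \<partial>\<mu>) = 0"
      using H(7) by (simp add: riesz_potential_def)
  qed
  then show ?thesis by blast
qed

lemma partition_function_ge_abs_pair_sum:
  assumes s: "s > 0" "s < real CARD('d)" and \<beta>: "\<beta> > 0" and N: "N \<ge> 1"
  shows "partition_function s \<beta> \<mu> N \<ge> exp (- \<beta> * riesz_energy s \<mu>) * (\<beta> / (4 * real N)) *
    (\<integral>x. \<bar>pair_sum (centered_kernel s \<mu>) {1..N} x\<bar> \<partial>PiM {1..N} (\<lambda>_. \<mu>))"
proof -
  obtain H where H: "H > 0" "\<And>x. integrable \<mu> (\<lambda>y. riesz_kernel s (x - y))"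
    "\<And>x. (\<integral>\<^sup>+y. riesz_kernel s (x - y) \<partial>\<mu>) \<le> ennreal H"
    "\<And>x. 0 \<le> riesz_potential s \<mu> x" "\<And>x. riesz_potential s \<mu> x \<le> H"
    "integrable \<mu> (riesz_potential s \<mu>)"
    "2 * riesz_energy s \<mu> = (\<integral>x. riesz_potential s \<mu> x \<partial>\<mu>)"
    "0 \<le> riesz_energy s \<mu>" "2 * riesz_energy s \<mu> \<le> H"
    using riesz_bounds[OF s] by metis
  obtain B' where "degenerate_kernel \<mu> (centered_kernel s \<mu>) B'"
    using centered_kernel_degenerate[OF s] by blast
  then interpret K: degenerate_kernel \<mu> "centered_kernel s \<mu>" B' .
  let ?P = "PiM {1..N} (\<lambda>_. \<mu>)"
  interpret P: prob_space ?P by (intro prob_space_PiM prob_space_axioms)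
  define U where "U = pair_sum (centered_kernel s \<mu>) {1..N}"
  define E where "E = (\<lambda>X. exp (- \<beta> * real N * modulated_energy s \<mu> N X))"
  define G where "G = exp (- \<beta> * riesz_energy s \<mu>)"
  have Um [measurable]: "U \<in> borel_measurable ?P"
    unfolding U_def by (rule measurable_pair_sum[OF K.kernel_measurable order_refl])
  have Ui: "integrable ?P U" unfolding U_def by (rule K.integrable_pair_sum) simp
  have U0: "(\<integral>x. U x \<partial>?P) = 0" unfolding U_def by (rule K.integral_pair_sum) simp
  have hm [measurable]: "(\<lambda>X. riesz_potential s \<mu> (X i)) \<in> borel_measurable ?P" if "i \<in> {1..N}" for i
    using that measurable_compose[OF measurable_component_singleton[of i "{1..N}" "\<lambda>_. \<mu>"], of "riesz_potential s \<mu>" borel]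
    by simp
  have energy: "- \<beta> * real N * modulated_energy s \<mu> N X
      = - (\<beta> / (2 * real N)) * U X + \<beta> / real N * (\<Sum>i\<in>{1..N}. riesz_potential s \<mu> (X i)) - \<beta> * riesz_energy s \<mu>" for X
    using N unfolding modulated_energy_def U_def pair_sum_def by (simp add: field_simps power2_eq_square)
  have Em: "E \<in> borel_measurable ?P"
    unfolding E_def energy by measurable
  \<comment> \<open>|U| - U is twice the negative part of \<open>U\<close>, which turns \<beta>/(2N)
    into \<beta>/(4N). As \<open>U\<close> has mean zero, |U| - U has the same mean as |U|.\<close>
  have Elow: "E X \<ge> G * (\<beta> / (4 * real N)) * (\<bar>U X\<bar> - U X)" for X
  proof -
    define w where "w = - (\<beta> / (2 * real N)) * U X"
    have "0 \<le> \<beta> / real N * (\<Sum>i\<in>{1..N}. riesz_potential s \<mu> (X i))"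
      using \<beta> H(4) by (intro mult_nonneg_nonneg sum_nonneg) auto
    then have "exp (w + (- \<beta> * riesz_energy s \<mu>)) \<le> E X"
      unfolding E_def energy w_def by simp
    moreover have "(\<bar>w\<bar> + w) / 2 \<le> exp w"
    proof -
      have "w \<le> exp w" using exp_ge_add_one_self[of w] by linarith
      then show ?thesis by (auto simp: abs_if)
    qed
    then have "G * ((\<bar>w\<bar> + w) / 2) \<le> G * exp w"
      by (intro mult_left_mono) (auto simp: G_def)
    moreover have "G * exp w = exp (w + (- \<beta> * riesz_energy s \<mu>))"
      by (simp only: G_def exp_add mult.commute)
    moreover have "G * ((\<bar>w\<bar> + w) / 2) = G * (\<beta> / (4 * real N)) * (\<bar>U X\<bar> - U X)"
      using \<beta> N by (simp add: w_def abs_mult field_simps)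
    ultimately show ?thesis by linarith
  qed
  \<comment> \<open>This serves the integrability of \<open>E\<close>; a Bochner integral that fails
    to exist would be 0 by convention. The singularity of the kernel is positive, so the kernel is
    bounded below and \<open>E\<close> is bounded for each fixed \<open>N\<close>.\<close>
  have Eup: "E X \<le> exp (\<beta> * H * real N + \<beta> * H)" for X
  proof -
    have "centered_kernel s \<mu> u v \<ge> - (2 * H)" for u v
      using H(5)[of u] H(5)[of v] H(8) riesz_kernel_nonneg[OF s(1), of "u - v"]
      unfolding centered_kernel_def by linarith
    then have "U X \<ge> (\<Sum>i\<in>{1..N}. \<Sum>j\<in>{1..N} - {i}. - (2 * H))"
      unfolding U_def pair_sum_def by (intro sum_mono)
    also have "(\<Sum>i\<in>{1..N}. \<Sum>j\<in>{1..N} - {i}. - (2 * H)) = - (real N * (real N - 1) * (2 * H))"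
      using N by (simp add: of_nat_diff)
    finally have "- U X \<le> real N * (real N - 1) * (2 * H)" by simp
    also have "\<dots> \<le> real N * real N * (2 * H)"
      using H(1) by (intro mult_right_mono mult_left_mono) auto
    finally have "\<beta> / (2 * real N) * (- U X) \<le> \<beta> / (2 * real N) * (real N * real N * (2 * H))"
      using \<beta> by (intro mult_left_mono) auto
    then have 1: "- (\<beta> / (2 * real N)) * U X \<le> \<beta> * H * real N"
      using N by (simp add: field_simps)
    have "(\<Sum>i\<in>{1..N}. riesz_potential s \<mu> (X i)) \<le> (\<Sum>i\<in>{1..N}. H)"
      by (intro sum_mono H)
    then have "\<beta> / real N * (\<Sum>i\<in>{1..N}. riesz_potential s \<mu> (X i)) \<le> \<beta> / real N * (real N * H)"
      using \<beta> by (intro mult_left_mono) auto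
    then have "\<beta> / real N * (\<Sum>i\<in>{1..N}. riesz_potential s \<mu> (X i)) \<le> \<beta> * H"
      using N by simp
    moreover have "\<beta> * riesz_energy s \<mu> \<ge> 0" using \<beta> H(8) by simp
    ultimately show ?thesis
      unfolding E_def energy using 1 by simp
  qed
  have Ei: "integrable ?P E"
    using Em Eup by (intro P.integrable_const_bound[where B = "exp (\<beta> * H * real N + \<beta> * H)"])
      (auto simp: E_def)
  have "G * (\<beta> / (4 * real N)) * (\<integral>X. \<bar>U X\<bar> \<partial>?P)
      = (\<integral>X. G * (\<beta> / (4 * real N)) * (\<bar>U X\<bar> - U X) \<partial>?P)"
    using Ui U0 by simp
  also have "\<dots> \<le> (\<integral>X. E X \<partial>?P)"
    using Ui Ei Elow by (intro integral_mono) auto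
  finally show ?thesis
    unfolding partition_function_def E_def G_def U_def .
qed

end

section \<open>Choice of the truncation and its constants\<close>

context bounded_density
begin

text \<open>The sum under the root is, up to a constant, the integral of |x - y|^(-2s) over
  \<open>n\<close> shells. The condition relating \<open>n\<close> and \<open>N\<close> says that
  the cutoff satisfies \<rho>^n >= N^(-1/s).\<close>

lemma partition_function_ge_sqrt:
  assumes s: "s > 0" "s < real CARD('d)" and \<beta>: "\<beta> > 0"
  shows "\<exists>c>0. \<exists>\<rho>. 0 < \<rho> \<and> \<rho> < 1 \<and> (\<forall>N n. N \<ge> 2 \<longrightarrow> n \<ge> 1 \<longrightarrow> (\<rho> powr (- s)) ^ n \<le> real N \<longrightarrow>
    partition_function s \<beta> \<mu> N \<ge> c * sqrt (\<Sum>k<n. (\<rho> powr (real CARD('d) - 2 * s)) ^ k))"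
proof -
  obtain H where H: "H > 0" "\<And>x. integrable \<mu> (\<lambda>y. riesz_kernel s (x - y))"
    "\<And>x. (\<integral>\<^sup>+y. riesz_kernel s (x - y) \<partial>\<mu>) \<le> ennreal H"
    "\<And>x. 0 \<le> riesz_potential s \<mu> x" "\<And>x. riesz_potential s \<mu> x \<le> H"
    "integrable \<mu> (riesz_potential s \<mu>)"
    "2 * riesz_energy s \<mu> = (\<integral>x. riesz_potential s \<mu> x \<partial>\<mu>)"
    "0 \<le> riesz_energy s \<mu>" "2 * riesz_energy s \<mu> \<le> H"
    using riesz_bounds[OF s] by metis
  obtain B' where "degenerate_kernel \<mu> (centered_kernel s \<mu>) B'"
    using centered_kernel_degenerate[OF s] by blast
  then interpret K: degenerate_kernel \<mu> "centered_kernel s \<mu>" B' .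
  let ?d = "real CARD('d)"
  \<comment> \<open>The square of half the Riesz kernel is \<kappa> |z|^(-2s).\<close>
  define \<kappa> where "\<kappa> = 1 / (4 * s\<^sup>2)"
  have \<kappa>: "\<kappa> > 0" using s by (simp add: \<kappa>_def)
  \<comment> \<open>Below this distance the Riesz kernel is at least 4 H, and subtracting two
    potentials, each at most H, leaves at least half of it. The bound 1 is the range of the estimate
    for close pairs.\<close>
  define r where "r = min 1 ((4 * s * H) powr (- 1 / s))"
  have r: "0 < r" "r \<le> 1" using s H(1) by (auto simp: r_def)
  have r_large: "4 * H \<le> riesz_kernel s z" if "z \<noteq> 0" "norm z < r" for z :: "real ^ 'd"
  proof -
    have "4 * s * H = ((4 * s * H) powr (- 1 / s)) powr (- s)"
      using s H(1) by (simp add: powr_powr)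
    also have "\<dots> \<le> norm z powr (- s)"
      using that s by (intro powr_mono2') (auto simp: r_def)
    finally show ?thesis using s by (simp add: riesz_kernel_def field_simps)
  qed
  obtain c where c: "c > 0"
    "\<And>t. 0 < t \<Longrightarrow> t \<le> 1 \<Longrightarrow> ennreal (c * t ^ CARD('d)) \<le> (\<integral>\<^sup>+x. emeasure \<mu> (ball x t) \<partial>\<mu>)"
    using close_pairs_lower_bound by blast
  \<comment> \<open>The second entry gives C r^d >= 1, which is needed when \<open>b\<close> is
    compared with N^2 p.\<close>
  define C where "C = max ball_const (r powr (- ?d))"
  have C: "C \<ge> ball_const" "C \<ge> r powr (- ?d)" by (auto simp: C_def)
  have C0: "C > 0" by (rule less_le_trans[OF _ C(2)]) (use r in simp)
  define \<rho> where "\<rho> = min (1 / 2) (c / (2 * C))"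
  have \<rho>: "0 < \<rho>" "\<rho> < 1" using c(1) C0 by (auto simp: \<rho>_def)
  have small: "C * \<rho> ^ CARD('d) \<le> c / 2"
  proof -
    have "\<rho> ^ CARD('d) \<le> \<rho> ^ 1" using \<rho> by (intro power_decreasing) (auto simp: Suc_leI)
    also have "\<dots> \<le> c / (2 * C)" by (simp add: \<rho>_def)
    finally have "C * \<rho> ^ CARD('d) \<le> C * (c / (2 * C))" using C0 by (intro mult_left_mono) auto
    then show ?thesis using C0 by simp
  qed
  define \<theta> where "\<theta> = \<rho> powr (?d - 2 * s)"
  have \<theta>: "\<theta> > 0" using \<rho> by (simp add: \<theta>_def)
  define K0 where "K0 = \<kappa> * (C * r powr (?d - 2 * s) * \<rho> powr (- (2 * s)))"
  have K0: "K0 > 0" using \<kappa> C0 r \<rho> by (simp add: K0_def)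
  \<comment> \<open>The quotient of the lower and the upper constant for the integral of \<phi>; it
    depends on neither \<open>n\<close> nor \<open>N\<close>.\<close>
  define \<eta> where "\<eta> = c / (2 * C * \<rho> powr (- (2 * s)))"
  have \<eta>: "\<eta> > 0" using c(1) C0 \<rho> by (simp add: \<eta>_def)
  define c0 where "c0 = exp (- \<beta> * riesz_energy s \<mu>) * (\<beta> / 4) * (\<eta> / (600 * sqrt (12 / \<eta>))) * sqrt K0"
  have c0: "c0 > 0" using \<beta> \<eta> K0 by (simp add: c0_def)
  have main: "partition_function s \<beta> \<mu> N \<ge> c0 * sqrt (\<Sum>k<n. \<theta> ^ k)"
    if N: "N \<ge> 2" and n: "n \<ge> 1" and nN: "(\<rho> powr (- s)) ^ n \<le> real N" for N n :: nat
  proof -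
    let ?L = "\<Sum>k<n. \<theta> ^ k"
    let ?k = "centered_kernel s \<mu>"
    define T where "T = (truncated_kernel (2 * s) r \<rho> n :: real ^ 'd \<Rightarrow> real)"
    define \<phi> where "\<phi> = (\<lambda>u v. \<kappa> * T (u - v))"
    define p where "p = K0 * ?L"
    define b where "b = \<kappa> * (r * \<rho> ^ n) powr (- (2 * s))"
    have L: "?L \<ge> 1"
    proof -
      have "(\<Sum>k<1. \<theta> ^ k) \<le> ?L" using n \<theta> by (intro sum_mono2) auto
      then show ?thesis by simp
    qed
    have p: "p > 0" using K0 L by (simp add: p_def)
    have T0: "T z \<ge> 0" for z by (simp add: T_def truncated_kernel_nonneg)
    have Tm [measurable]: "T \<in> borel_measurable borel" by (simp add: T_def measurable_truncated_kernel)
    have meas: "case_prod \<phi> \<in> borel_measurable (\<mu> \<Otimes>\<^sub>M \<mu>)"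
    proof -
      have "(\<lambda>z. \<kappa> * T (fst z - snd z)) \<in> borel_measurable (borel \<Otimes>\<^sub>M borel)" by measurable
      moreover have "borel_measurable (\<mu> \<Otimes>\<^sub>M \<mu>) = (borel_measurable (borel \<Otimes>\<^sub>M borel) :: (_ \<Rightarrow> real) set)"
        by (intro measurable_cong_sets sets_pair_measure_cong) auto
      ultimately show ?thesis by (simp add: case_prod_beta' \<phi>_def)
    qed
    have mult: "(\<integral>\<^sup>+v. \<phi> u v \<partial>\<mu>) = ennreal \<kappa> * (\<integral>\<^sup>+v. T (u - v) \<partial>\<mu>)" for u
    proof -
      have "(\<integral>\<^sup>+v. \<phi> u v \<partial>\<mu>) = (\<integral>\<^sup>+v. ennreal \<kappa> * ennreal (T (u - v)) \<partial>\<mu>)"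
        using \<kappa> T0 by (intro nn_integral_cong) (simp add: \<phi>_def ennreal_mult)
      also have "\<dots> = ennreal \<kappa> * (\<integral>\<^sup>+v. T (u - v) \<partial>\<mu>)"
        by (rule nn_integral_cmult) measurable
      finally show ?thesis .
    qed
    have "\<eta> / (600 * sqrt (12 / \<eta>)) * real (card {1..N}) * sqrt p
        \<le> (\<integral>x. \<bar>pair_sum ?k {1..N} x\<bar> \<partial>PiM {1..N} (\<lambda>_. \<mu>))"
    proof (rule K.abs_pair_sum_lower_bound[where \<phi> = \<phi> and b = b])
      show "case_prod \<phi> \<in> borel_measurable (\<mu> \<Otimes>\<^sub>M \<mu>)" by (rule meas)
      fix u v :: "real ^ 'd"
      show "0 \<le> \<phi> u v" using \<kappa> T0 by (simp add: \<phi>_def)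
      show "\<phi> u v = \<phi> v u" by (simp add: \<phi>_def T_def truncated_kernel_def norm_minus_commute)
      show "\<phi> u v \<le> b"
      proof -
        have "T (u - v) \<le> (r * \<rho> ^ n) powr (- (2 * s))"
          using r \<rho> s by (auto simp: T_def truncated_kernel_def intro!: powr_mono2')
        then show ?thesis using \<kappa> by (simp add: \<phi>_def b_def)
      qed
      show "\<phi> u v \<le> (?k u v)\<^sup>2"
      proof (cases "r * \<rho> ^ n \<le> norm (u - v) \<and> norm (u - v) < r")
        case True
        moreover have "0 < r * \<rho> ^ n" using r \<rho> by simp
        ultimately have z: "u - v \<noteq> 0" "norm (u - v) < r" by auto
        have "riesz_kernel s (u - v) / 2 \<le> ?k u v"
          using r_large[OF z] H(5)[of u] H(5)[of v] H(8) unfolding centered_kernel_def by linarith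
        then have "(riesz_kernel s (u - v) / 2)\<^sup>2 \<le> (?k u v)\<^sup>2"
          using riesz_kernel_nonneg[OF s(1)] by (intro power_mono) auto
        moreover have "(riesz_kernel s (u - v) / 2)\<^sup>2 = \<kappa> * norm (u - v) powr (- (2 * s))"
          by (simp add: riesz_kernel_def \<kappa>_def power2_eq_square powr_add[symmetric])
        ultimately show ?thesis using True by (simp add: \<phi>_def T_def truncated_kernel_def)
      qed (auto simp: \<phi>_def T_def truncated_kernel_def)
      have "ennreal \<kappa> * (\<integral>\<^sup>+v. T (u - v) \<partial>\<mu>)
          \<le> ennreal \<kappa> * ennreal (C * r powr (?d - 2 * s) * \<rho> powr (- (2 * s)) * ?L)"
        unfolding T_def \<theta>_def using s r \<rho> C by (intro mult_left_mono nn_integral_truncated_le) auto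
      also have "\<dots> = ennreal p"
        using \<kappa> C0 L by (subst ennreal_mult[symmetric]) (auto simp: p_def K0_def mult_ac)
      finally show "(\<integral>\<^sup>+v. \<phi> u v \<partial>\<mu>) \<le> ennreal p" unfolding mult .
    next
      have "\<eta> * p = \<kappa> * (c / 2 * r powr (?d - 2 * s) * ?L)"
        using C0 \<rho> by (simp add: \<eta>_def p_def K0_def field_simps)
      then have "ennreal (\<eta> * p) = ennreal \<kappa> * ennreal (c / 2 * r powr (?d - 2 * s) * ?L)"
        using \<kappa> c(1) L by (simp only:) (intro ennreal_mult mult_nonneg_nonneg; simp)
      also have "\<dots> \<le> ennreal \<kappa> * (\<integral>\<^sup>+u. \<integral>\<^sup>+v. T (u - v) \<partial>\<mu> \<partial>\<mu>)"
        unfolding T_def \<theta>_def using s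
        by (intro mult_left_mono nn_integral_truncated_ge[OF \<rho> r _ C(1) c(1) c(2) small]) auto
      also have "\<dots> = (\<integral>\<^sup>+u. \<integral>\<^sup>+v. \<phi> u v \<partial>\<mu> \<partial>\<mu>)"
        unfolding mult
      proof (rule nn_integral_cmult[symmetric])
        have "(\<lambda>u. \<integral>\<^sup>+v. T (u - v) \<partial>\<mu>) \<in> borel_measurable borel" by measurable
        then show "(\<lambda>u. \<integral>\<^sup>+v. T (u - v) \<partial>\<mu>) \<in> borel_measurable \<mu>" by simp
      qed
      finally show "ennreal (\<eta> * p) \<le> (\<integral>\<^sup>+u. \<integral>\<^sup>+v. \<phi> u v \<partial>\<mu> \<partial>\<mu>)" .
    next
      \<comment> \<open>The maximum of \<phi> is of order \<rho>^(-2sn), at most N^2 by the choice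
        of \<open>n\<close>. The constants are absorbed into \<open>p\<close> because C r^d,
        \<rho>^(-2s) and the geometric sum are all at least 1.\<close>
      have "(r * \<rho> ^ n) powr (- (2 * s)) = r powr (- (2 * s)) * ((\<rho> powr (- s)) ^ n)\<^sup>2"
        using r \<rho> by (simp add: powr_mult powr_power powr_powr power_mult[symmetric] mult_ac flip: powr_realpow)
      also have "\<dots> \<le> r powr (- (2 * s)) * (real N)\<^sup>2"
        using nN by (intro mult_left_mono power_mono) auto
      also have "\<dots> \<le> (r powr (- (2 * s)) * (real N)\<^sup>2) * ((C * r powr ?d) * \<rho> powr (- (2 * s)) * ?L)"
      proof -
        have "1 = r powr (- ?d) * r powr ?d" using r by (simp add: powr_add[symmetric])
        also have "\<dots> \<le> C * r powr ?d" using C by (intro mult_right_mono) auto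
        finally have "1 \<le> C * r powr ?d" .
        moreover have "1 \<le> \<rho> powr (- (2 * s))"
          using \<rho> s by (simp add: powr_minus one_le_inverse powr_le1)
        ultimately have "1 \<le> (C * r powr ?d) * \<rho> powr (- (2 * s)) * ?L"
          by (rule mult_ge1_I[OF mult_ge1_I L])
        then have "(r powr (- (2 * s)) * (real N)\<^sup>2) * 1
            \<le> (r powr (- (2 * s)) * (real N)\<^sup>2) * ((C * r powr ?d) * \<rho> powr (- (2 * s)) * ?L)"
          by (intro mult_left_mono) auto
        then show ?thesis by simp
      qed
      also have "\<dots> = (real N)\<^sup>2 * (C * r powr (?d - 2 * s) * \<rho> powr (- (2 * s)) * ?L)"
        using r by (simp add: powr_diff powr_minus divide_inverse mult_ac)
      finally have "\<kappa> * (r * \<rho> ^ n) powr (- (2 * s))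
          \<le> \<kappa> * ((real N)\<^sup>2 * (C * r powr (?d - 2 * s) * \<rho> powr (- (2 * s)) * ?L))"
        using \<kappa> by (intro mult_left_mono) auto
      then show "b \<le> (real (card {1..N}))\<^sup>2 * p"
        by (simp add: b_def p_def K0_def mult_ac)
    qed (use N \<eta> p in auto)
    then have U: "\<eta> / (600 * sqrt (12 / \<eta>)) * real N * sqrt p
        \<le> (\<integral>x. \<bar>pair_sum ?k {1..N} x\<bar> \<partial>PiM {1..N} (\<lambda>_. \<mu>))"
      by simp
    \<comment> \<open>The factor \<open>N\<close> gained in the mean of |U| cancels the 1/N of the
      prefactor; only the root of the geometric sum still depends on \<open>n\<close>.\<close>
    have "c0 * sqrt ?L = exp (- \<beta> * riesz_energy s \<mu>) * (\<beta> / (4 * real N)) * (\<eta> / (600 * sqrt (12 / \<eta>)) * real N * sqrt p)"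
      using N by (simp add: c0_def p_def real_sqrt_mult)
    also have "\<dots> \<le> exp (- \<beta> * riesz_energy s \<mu>) * (\<beta> / (4 * real N)) *
        (\<integral>x. \<bar>pair_sum ?k {1..N} x\<bar> \<partial>PiM {1..N} (\<lambda>_. \<mu>))"
      using \<beta> by (intro mult_left_mono U) auto
    also have "\<dots> \<le> partition_function s \<beta> \<mu> N"
      using N by (intro partition_function_ge_abs_pair_sum s \<beta>) auto
    finally show ?thesis .
  qed
  show ?thesis
    using c0 \<rho> main unfolding \<theta>_def by blast
qed

end

section \<open>Growth rates\<close>

lemma bounded_density_of_prob:
  fixes \<mu> :: "(real ^ 'd) measure"
  assumes "bounded_density_prob \<mu>"
  shows "\<exists>B. bounded_density \<mu> B"
proof -
  obtain f M where f: "f \<in> borel_measurable borel" "\<And>x. 0 \<le> f x" "AE x in lborel. f x \<le> M"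
      "\<mu> = density lborel (\<lambda>x. ennreal (f x))" and "prob_space \<mu>"
    using assms by (auto simp: bounded_density_prob_def)
  interpret prob_space \<mu> by fact
  have "bounded_density \<mu> (max 0 M)"
  proof
    show "sets \<mu> = sets borel" by (simp add: f(4))
    show "0 \<le> max 0 M" by simp
    fix A :: "(real ^ 'd) set" assume A: "A \<in> sets borel"
    have "emeasure \<mu> A = (\<integral>\<^sup>+x. ennreal (f x) * indicator A x \<partial>lborel)"
      unfolding f(4) using f(1) A by (intro emeasure_density) auto
    also have "\<dots> \<le> (\<integral>\<^sup>+x. ennreal (max 0 M) * indicator A x \<partial>lborel)"
      using f(3) by (intro nn_integral_mono_AE) (auto intro!: mult_right_mono ennreal_leI elim!: eventually_mono)
    also have "\<dots> = ennreal (max 0 M) * emeasure lborel A"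
      using A by (intro nn_integral_cmult_indicator) simp
    finally show "emeasure \<mu> A \<le> ennreal (max 0 M) * emeasure lborel A" .
  qed
  then show ?thesis by blast
qed

theorem proposition5p10:
  fixes \<mu> :: "(real ^ 'd) measure" and s \<beta> :: real
  assumes "\<beta> > 0"
    and "real CARD('d) / 2 \<le> s" and "s < real CARD('d)" and "s > 0"
    and "bounded_density_prob \<mu>"
  shows "(\<exists>(c::real) (C::real) (N0::nat). c > 0 \<and> C > 0 \<and> N0 \<ge> 3 \<and>
           (\<forall>N\<ge>N0. partition_function s \<beta> \<mu> N \<ge>
              inverse C * (if s = real CARD('d) / 2 then ln (real N) powr c
                           else exp (c * ln (real N) powr (2 - real CARD('d) / s))))) \<and>
         filterlim (\<lambda>N. partition_function s \<beta> \<mu> N) at_top sequentially"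
proof -
  let ?d = "real CARD('d)"
  let ?K = "partition_function s \<beta> \<mu>"
  define \<gamma> where "\<gamma> = 2 - ?d / s"
  obtain B where "bounded_density \<mu> B" using bounded_density_of_prob[OF assms(5)] by blast
  then interpret bounded_density \<mu> B .
  obtain c0 \<rho> where c0: "c0 > 0" and \<rho>: "0 < \<rho>" "\<rho> < 1"
    and K: "\<And>N n. N \<ge> 2 \<Longrightarrow> n \<ge> 1 \<Longrightarrow> (\<rho> powr (- s)) ^ n \<le> real N \<Longrightarrow>
      ?K N \<ge> c0 * sqrt (\<Sum>k<n. (\<rho> powr (?d - 2 * s)) ^ k)"
    using partition_function_ge_sqrt[OF assms(4,3,1)] by blast
  \<comment> \<open>In these units the condition on the cutoff reads n l <= ln N. As \<gamma> s = 2s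
    - d, the ratio of consecutive shells is exp(\<gamma> l).\<close>
  define l where "l = s * ln (1 / \<rho>)"
  have l: "l > 0" using assms(4) \<rho> by (simp add: l_def ln_div mult_pos_neg)
  have q: "\<rho> powr (- s) = exp l" using \<rho> by (simp add: powr_def l_def ln_div)
  have \<theta>: "\<rho> powr (?d - 2 * s) = exp (\<gamma> * l)"
    using \<rho> assms(4) by (simp add: powr_def l_def ln_div \<gamma>_def field_simps)
  have ex_n: "\<exists>n\<ge>1. real n \<ge> ln (real N) / l - 1 \<and> ?K N \<ge> c0 * sqrt (\<Sum>k<n. exp (\<gamma> * l) ^ k)"
    if N: "N \<ge> 2" "ln (real N) \<ge> l" for N
  proof -
    \<comment> \<open>The largest number of shells that the condition on the cutoff allows.\<close>
    define n where "n = nat \<lfloor>ln (real N) / l\<rfloor>"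
    have "1 \<le> ln (real N) / l" using N l by simp
    then have "1 \<le> \<lfloor>ln (real N) / l\<rfloor>" by (simp add: le_floor_iff)
    then have n: "n \<ge> 1" "real n = of_int \<lfloor>ln (real N) / l\<rfloor>" unfolding n_def by linarith+
    then have "real n \<le> ln (real N) / l" "real n \<ge> ln (real N) / l - 1" by linarith+
    then have "exp (real n * l) \<le> exp (ln (real N))" using l by (simp add: field_simps)
    then have "(\<rho> powr (- s)) ^ n \<le> real N" using N by (simp add: q exp_of_nat_mult)
    from K[OF N(1) n(1) this] show ?thesis
      using n(1) \<open>real n \<ge> ln (real N) / l - 1\<close> unfolding \<theta> by blast
  qed
  have ln_top: "filterlim (\<lambda>N::nat. ln (real N)) at_top sequentially"
    by (rule filterlim_compose[OF ln_at_top filterlim_real_sequentially])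
  \<comment> \<open>The bound 1 makes powers of ln N monotone in the exponent; the bound 2 l gives
    ln N / l - 1 >= ln N / (2 l).\<close>
  have "eventually (\<lambda>N::nat. ln (real N) \<ge> max 1 (2 * l)) sequentially"
    using ln_top unfolding filterlim_at_top by blast
  then obtain N1 where N1: "\<And>N. N \<ge> N1 \<Longrightarrow> ln (real N) \<ge> max 1 (2 * l)"
    unfolding eventually_sequentially by blast
  define N0 where "N0 = max 3 N1"
  have ln_ge: "ln (real N) \<ge> 1" "ln (real N) \<ge> 2 * l" "N \<ge> 2" if "N \<ge> N0" for N
    using N1[of N] that by (auto simp: N0_def)
  show ?thesis
  proof (cases "s = ?d / 2")
    case True
    then have "\<gamma> = 0" unfolding \<gamma>_def using assms(4) by (simp add: field_simps)
    \<comment> \<open>At \<gamma> = 0 the geometric sum is \<open>n\<close>, which is at least ln N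
      / (2 l); its root gives the exponent 1/2.\<close>
    define C where "C = sqrt (2 * l) / c0"
    have C: "C > 0" using l c0 by (simp add: C_def)
    have bound: "?K N \<ge> inverse C * ln (real N) powr (1 / 2)" if "N \<ge> N0" for N
    proof -
      note N = ln_ge[OF that]
      then have "ln (real N) \<ge> l" using l by linarith
      from ex_n[OF N(3) this] obtain n where n: "n \<ge> 1" "real n \<ge> ln (real N) / l - 1" "?K N \<ge> c0 * sqrt (real n)"
        using \<open>\<gamma> = 0\<close> by auto
      have "ln (real N) / (2 * l) \<le> ln (real N) / l - 1" using N(2) l by (simp add: field_simps)
      then have "sqrt (ln (real N) / (2 * l)) \<le> sqrt (real n)" using n(2) by (intro real_sqrt_le_mono) linarith
      then have "c0 * sqrt (ln (real N) / (2 * l)) \<le> c0 * sqrt (real n)" using c0 by simp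
      moreover have "c0 * sqrt (ln (real N) / (2 * l)) = inverse C * ln (real N) powr (1 / 2)"
        using N(1) by (simp add: C_def powr_half_sqrt real_sqrt_divide)
      ultimately show ?thesis using n(3) by linarith
    qed
    have "filterlim (\<lambda>N. inverse C * ln (real N) powr (1 / 2)) at_top sequentially"
      using C ln_top by (intro filterlim_tendsto_pos_mult_at_top[OF tendsto_const]
          filterlim_compose[OF real_powr_at_top]) auto
    then have "filterlim ?K at_top sequentially"
      by (rule filterlim_at_top_mono) (use bound in \<open>auto simp: eventually_sequentially\<close>)
    moreover have "\<exists>c C N0. c > 0 \<and> C > 0 \<and> N0 \<ge> 3 \<and> (\<forall>N\<ge>N0. ?K N \<ge> inverse C * (ln (real N) powr c))"
      using bound C by (intro exI[of _ "1 / 2"] exI[of _ C] exI[of _ N0]) (auto simp: N0_def)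
    moreover have "(s = ?d / 2) = True" using True by simp
    ultimately show ?thesis by (simp only: if_True simp_thms)
  next
    case False
    then have "?d < 2 * s" using assms(2) by simp
    then have \<gamma>: "0 < \<gamma>" "\<gamma> \<le> 1" using assms(3,4) by (auto simp: \<gamma>_def field_simps)
    define C where "C = exp (\<gamma> * l) / c0"
    have C: "C > 0" using c0 by (simp add: C_def)
    have bound: "?K N \<ge> inverse C * exp (\<gamma> / 2 * ln (real N) powr \<gamma>)" if "N \<ge> N0" for N
    proof -
      note N = ln_ge[OF that]
      then have "ln (real N) \<ge> l" using l by linarith
      from ex_n[OF N(3) this] obtain n where n: "n \<ge> 1" "real n \<ge> ln (real N) / l - 1"
        "?K N \<ge> c0 * sqrt (\<Sum>k<n. exp (\<gamma> * l) ^ k)"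
        by blast
      \<comment> \<open>The argument yields the power N^(\<gamma>/2). Since \<gamma> <= 1 by s < d,
        this is stronger than the claimed rate and is weakened here.\<close>
      have "ln (real N) powr \<gamma> \<le> ln (real N) powr 1" using N(1) \<gamma> by (intro powr_mono) auto
      then have "\<gamma> / 2 * ln (real N) powr \<gamma> \<le> \<gamma> / 2 * ln (real N)"
        using \<gamma> N(1) by (intro mult_left_mono) auto
      \<comment> \<open>The shape ln N / l - 2 matches the lower bound for n - 1; the surplus
        \<gamma> l is what the factor exp(\<gamma> l) in \<open>C\<close> absorbs.\<close>
      also have "\<dots> = \<gamma> * l * (ln (real N) / l - 2) / 2 + \<gamma> * l"
        using l by (simp add: field_simps)
      also have "\<dots> \<le> \<gamma> * l * real (n - 1) / 2 + \<gamma> * l"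
        using n \<gamma> l by (intro add_right_mono divide_right_mono mult_left_mono) (auto simp: of_nat_diff)
      finally have "exp (\<gamma> / 2 * ln (real N) powr \<gamma>) \<le> exp (\<gamma> * l * real (n - 1) / 2 + \<gamma> * l)"
        by simp
      also have "\<dots> = exp (\<gamma> * l) * exp (\<gamma> * l * real (n - 1) / 2)"
        by (simp add: exp_add)
      finally have "inverse C * exp (\<gamma> / 2 * ln (real N) powr \<gamma>) \<le> c0 * exp (\<gamma> * l * real (n - 1) / 2)"
        using c0 by (simp add: C_def field_simps)
      also have "exp (\<gamma> * l * real (n - 1) / 2) = sqrt (exp (\<gamma> * l) ^ (n - 1))"
      proof (rule real_sqrt_unique[symmetric])
        show "(exp (\<gamma> * l * real (n - 1) / 2))\<^sup>2 = exp (\<gamma> * l) ^ (n - 1)"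
          by (simp add: exp_of_nat2_mult[symmetric] exp_of_nat_mult[symmetric] exp_double[symmetric] mult_ac)
      qed simp
      \<comment> \<open>Only the innermost shell, the last and largest term of the sum, is
        kept.\<close>
      also have "c0 * sqrt (exp (\<gamma> * l) ^ (n - 1)) \<le> c0 * sqrt (\<Sum>k<n. exp (\<gamma> * l) ^ k)"
        using n(1) c0 by (intro mult_left_mono real_sqrt_le_mono member_le_sum) auto
      finally show ?thesis using n(3) by linarith
    qed
    have "filterlim (\<lambda>N. inverse C * exp (\<gamma> / 2 * ln (real N) powr \<gamma>)) at_top sequentially"
      using C \<gamma> ln_top
      by (intro filterlim_tendsto_pos_mult_at_top[OF tendsto_const] filterlim_compose[OF exp_at_top]
          filterlim_compose[OF real_powr_at_top]) auto
    then have "filterlim ?K at_top sequentially"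
      by (rule filterlim_at_top_mono) (use bound in \<open>auto simp: eventually_sequentially\<close>)
    moreover have "\<exists>c C N0. c > 0 \<and> C > 0 \<and> N0 \<ge> 3 \<and>
        (\<forall>N\<ge>N0. ?K N \<ge> inverse C * exp (c * ln (real N) powr \<gamma>))"
      using bound C \<gamma> by (intro exI[of _ "\<gamma> / 2"] exI[of _ C] exI[of _ N0]) (auto simp: N0_def)
    ultimately show ?thesis using False unfolding \<gamma>_def by (simp only: if_False simp_thms)
  qed
qed

end
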